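(* Let $R>0$, $0<R_0<R/\sqrt2$, $T_0>0$ and $T=T_0+R+R_0$. Let $h\in L^1(\mathbb R)$ be a given function with support in $(-R_0,R_0)$ and $h\neq0$ (not identically vanishing). For a function $\tilde f\in L^2(\mathbb R^2\times\mathbb R)$ compactly supported in $\tilde B_{R_0}\times[0,T_0]$, where $\tilde B_{R_0}=\{\tilde x\in\mathbb R^2:|\tilde x|<R_0\}$, let $u=u_{\tilde f}$ be the solution of $$\begin{cases}\partial_t^2u(x,t)-\Delta u(x,t)=\tilde f(\tilde x,t)\,h(x_3), & (x,t)\in\mathbb R^3\times\mathbb R^+,\\ u(x,0)=\partial_tu(x,0)=0, & x\in\mathbb R^3,\end{cases}$$ with $x=(x_1,x_2,x_3)$ and $\tilde x=(x_1,x_2)$. Then $\tilde f$ is uniquely determined by $\{u(x,t):x\in\Gamma_R,\ t\in(0,T)\}$, where $\Gamma_R=\{x\in\mathbb R^3:|x|=R\}$. That is, if $\tilde f_1,\tilde f_2$ are two such functions and $u_{\tilde f_1}=u_{\tilde f_2}$ on $\Gamma_R\times(0,T)$, then $\tilde f_1=\tilde f_2$.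
   Context: The solution $u$ is the causal solution of the wave equation, i.e. the convolution of the source $F(x,t)=\tilde f(\tilde x,t)h(x_3)$ (extended by $0$ for $t<0$) with the retarded fundamental solution: $u(x,t)=\int_{\mathbb R^3}\frac{F(y,t-|x-y|)}{4\pi|x-y|}\,\mathrm dy$. Since $\sqrt2R_0<R$, the source is supported in $\{|x|<R\}$ and the trace of $u$ on $\Gamma_R$ is given by this formula. *)

theory Defs
  imports "HOL-Analysis.Analysis"
begin

text \<open>Elements of \<open>L\<^sup>p\<close> are rendered by Lebesgue measurable representatives. All
  notions below, as well as the hypotheses and the conclusion of the theorem, are invariant under
  changing a representative on a null set. Values are complex, which includes the real case.\<close>

definition square_integrable :: "('a::euclidean_space \<Rightarrow> complex) \<Rightarrow> bool" where
  "square_integrable f \<longleftrightarrow>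
     f \<in> borel_measurable lebesgue \<and> integrable lebesgue (\<lambda>x. (norm (f x))\<^sup>2)"

text \<open>The support of a class of functions modulo null sets: the complement of the largest open set
  on which the function vanishes almost everywhere.\<close>

definition ess_support :: "('a::euclidean_space \<Rightarrow> complex) \<Rightarrow> 'a set" where
  "ess_support f = - \<Union>{U. open U \<and> (AE x in lebesgue. x \<in> U \<longrightarrow> f x = 0)}"

definition horizontal :: "real^3 \<Rightarrow> real^2" where
  "horizontal x = vector [x $ 1, x $ 2]"

definition wave_source ::
  "((real^2) \<times> real \<Rightarrow> complex) \<Rightarrow> (real \<Rightarrow> complex) \<Rightarrow> real^3 \<Rightarrow> real \<Rightarrow> complex" where
  "wave_source f h x t = (if t < 0 then 0 else f (horizontal x, t) * h (x $ 3))"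

text \<open>Convolution with the retarded fundamental solution of \<open>\<partial>\<^sub>t\<^sup>2 - \<Delta>\<close> in three space
  dimensions. For a source in \<open>L\<^sup>1(\<real>\<^sup>3 \<times> \<real>)\<close> whose spatial support has positive distance from
  \<open>x\<close>, the integral converges absolutely for almost every \<open>t\<close>; for the remaining \<open>t\<close> it has the
  default value \<open>0\<close>.\<close>

definition retarded_potential :: "(real^3 \<Rightarrow> real \<Rightarrow> complex) \<Rightarrow> real^3 \<Rightarrow> real \<Rightarrow> complex" where
  "retarded_potential F x t =
     (\<integral>y. F y (t - norm (x - y)) / complex_of_real (4 * pi * norm (x - y)) \<partial>lebesgue)"

definition wave_solution ::
  "((real^2) \<times> real \<Rightarrow> complex) \<Rightarrow> (real \<Rightarrow> complex) \<Rightarrow> real^3 \<Rightarrow> real \<Rightarrow> complex" where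
  "wave_solution f h = retarded_potential (wave_source f h)"

definition admissible_source :: "real \<Rightarrow> real \<Rightarrow> ((real^2) \<times> real \<Rightarrow> complex) \<Rightarrow> bool" where
  "admissible_source R\<^sub>0 T\<^sub>0 f \<longleftrightarrow>
     square_integrable f \<and> compact (ess_support f) \<and>
     ess_support f \<subseteq> ball 0 R\<^sub>0 \<times> {0..T\<^sub>0}"

text \<open>Equality of two wave fields on \<open>\<Gamma>\<^sub>R \<times> (0,T)\<close>: for every \<open>x\<close> on the sphere, the traces
  \<open>u(x,\<cdot>)\<close> agree as elements of \<open>L\<^sup>1(0,T)\<close>, i.e. for almost every time. (Changing \<open>f\<close> on a
  null set changes the trace at \<open>x\<close> only on a null set of times.)\<close>

definition same_boundary_data ::
  "real \<Rightarrow> real \<Rightarrow> (real^3 \<Rightarrow> real \<Rightarrow> complex) \<Rightarrow> (real^3 \<Rightarrow> real \<Rightarrow> complex) \<Rightarrow> bool" where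
  "same_boundary_data R T u v \<longleftrightarrow>
     (\<forall>x\<in>sphere 0 R. AE t in lebesgue. t \<in> {0<..<T} \<longrightarrow> u x t = v x t)"

end

theory Submission
  imports Defs "HOL-Complex_Analysis.Cauchy_Integral_Formula" "HOL-Real_Asymp.Real_Asymp"
begin

text \<open>By linearity the claim is that a source \<open>\<Phi>(y,s) = f(y',s) h(y\<^sub>3)\<close>, \<open>y = (y',y\<^sub>3)\<close>, with
  \<open>f = f\<^sub>1 - f\<^sub>2\<close>, vanishes as soon as its retarded potential \<open>u\<close> vanishes on \<open>\<Gamma>\<^sub>R \<times> (0,T)\<close>. The boundary
  data control the field outside the sphere, and the far field contains the integrals of
  \<open>\<Phi>\<close> against plane waves.

  The Laplace transform in time with parameter \<open>p > 0\<close> turns \<open>u(x,\<cdot>)\<close> into a superposition of Yukawa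
  kernels \<open>exp(-p|x-y|)/|x-y|\<close>, a solution of \<open>\<Delta>w = p\<^sup>2 w\<close> away from the source. Since \<open>u(x,\<cdot>)\<close>
  vanishes before time \<open>T\<close>, this \<open>w\<close> is \<open>O(exp(-pT))\<close> on \<open>\<Gamma>\<^sub>R\<close> (\<open>laplace_trace_bound\<close>). The maximum
  principle for the exterior of the sphere, with the Yukawa kernel centred at the origin as barrier,
  carries the bound to all \<open>|x| \<ge> R\<close>; letting \<open>x\<close> go to infinity in the direction \<open>\<theta>\<close> gives
  \<open>\<integral>\<integral> \<Phi>(y,s) exp(p(\<theta>\<cdot>y - s)) = O(exp(-p(T-R)))\<close> (\<open>abs_far_field_le\<close>). No time beyond \<open>T\<close> enters.

  A Laplace transform of this kind, whose exponent \<open>\<theta>\<cdot>y - s\<close> stays above some \<open>-c > -(T-R)\<close> on the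
  support of \<open>\<Phi>\<close>, cannot decay that fast unless it vanishes for every real \<open>p\<close>
  (\<open>exp_transform_zero_if_decays\<close>). As \<open>T - R = T\<^sub>0 + R\<^sub>0\<close>, this does not apply to all directions:
  on the cylinder \<open>|y'| < R\<^sub>0\<close>, \<open>|y\<^sub>3| < R\<^sub>0\<close> the quantity \<open>s - \<theta>\<cdot>y\<close> comes close to \<open>T\<^sub>0 + \<surd>2 R\<^sub>0\<close>. But the
  supports are compact, hence contained in a smaller cylinder of size \<open>r < R\<^sub>0\<close>, and there
  \<open>s - \<theta>\<cdot>y \<le> T\<^sub>0 + r + |\<theta>\<^sub>3| r < T\<^sub>0 + R\<^sub>0\<close> for every direction that is sufficiently close to horizontal.

  These directions suffice. The plane-wave integral factors into the Laplace transform of \<open>f\<close> at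
  \<open>(l\<theta>', -l)\<close> and the Laplace transform of \<open>h\<close> at \<open>l\<theta>\<^sub>3\<close>. The second factor is nonzero near some
  \<open>\<eta>\<^sub>0 \<noteq> 0\<close>, because \<open>h\<close> does not vanish identically, and for large \<open>l\<close> the requirement
  \<open>l\<theta>\<^sub>3 \<approx> \<eta>\<^sub>0\<close> forces \<open>\<theta>\<^sub>3\<close> to be small. So the Laplace transform of \<open>f\<close> vanishes on an open set
  (\<open>tensor_source_zero\<close>), and for compactly supported \<open>f\<close> this implies \<open>f = 0\<close>
  (\<open>AE_zero_if_laplace_zero_on_open\<close>).\<close>

section \<open>Uniqueness for the Laplace transform of a compactly supported function\<close>

text \<open>The closed sets form an intersection-stable generator of the Borel sets, so a Dynkin argument
  extends the hypothesis to all Borel sets.\<close>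

lemma AE_zero_if_integrals_zero_closed:
  fixes g :: "'a::euclidean_space \<Rightarrow> real"
  assumes g: "integrable lborel g"
    and closed: "\<And>C. closed C \<Longrightarrow> (\<integral>x. indicator C x *\<^sub>R g x \<partial>lborel) = 0"
  shows "AE x in lborel. g x = 0"
proof (rule sigma_finite_measure.density_zero[OF lborel.sigma_finite_measure_axioms g])
  fix A :: "'a set" assume "A \<in> sets lborel"
  then have A: "A \<in> sigma_sets UNIV (Collect closed)"
    using borel_eq_closed[where 'a='a] by (metis sets_lborel sets_measure_of subset_UNIV Pow_UNIV)
  have meas: "B \<in> sets lborel" if "B \<in> sigma_sets UNIV (Collect closed)" for B :: "'a set"
    using that borel_eq_closed[where 'a='a] by (metis sets_lborel sets_measure_of subset_UNIV Pow_UNIV)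
  have int: "set_integrable lborel B g" if "B \<in> sets lborel" for B
    unfolding set_integrable_def using integrable_mult_indicator[OF that g] .
  show "(LINT x:A|lborel. g x) = 0"
  proof (rule sigma_sets_induct_disjoint[OF _ _ A])
    show "Int_stable (Collect closed :: 'a set set)" by (auto simp: Int_stable_def)
    show "(LINT x:B|lborel. g x) = 0" if "B \<in> Collect closed" for B
      using closed[of B] that by (simp add: set_lebesgue_integral_def)
    show "(LINT x:(UNIV - B)|lborel. g x) = 0"
      if B: "B \<in> sigma_sets UNIV (Collect closed)" and 0: "(LINT x:B|lborel. g x) = 0" for B
    proof -
      have "(LINT x:B|lborel. g x) + (LINT x:(UNIV - B)|lborel. g x) = (LINT x:(B \<union> (UNIV - B))|lborel. g x)"
        by (rule set_integral_Un[symmetric]) (use int meas[OF B] in auto)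
      also have "\<dots> = 0" using closed[of UNIV] by (simp add: set_lebesgue_integral_def)
      finally show ?thesis using 0 by simp
    qed
    show "(LINT x:(\<Union>i. B i)|lborel. g x) = 0"
      if "disjoint_family B" and B: "range B \<subseteq> sigma_sets UNIV (Collect closed)"
        and "\<And>i. (LINT x:B i|lborel. g x) = 0" for B :: "nat \<Rightarrow> 'a set"
    proof (subst lebesgue_integral_countable_add)
      show "B i \<in> sets lborel" for i using B meas by auto
      then show "set_integrable lborel (\<Union>i. B i) g" by (intro int) auto
    qed (use that in \<open>auto simp: disjoint_family_on_def\<close>)
  qed (auto simp: set_lebesgue_integral_def)
qed

text \<open>The indicator function of a closed set is a decreasing limit of functions of the distance to it.\<close>

lemma AE_zero_if_integrals_zero_continuous:
  fixes g :: "'a::euclidean_space \<Rightarrow> real"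
  assumes g: "integrable lborel g"
    and cont: "\<And>\<psi> :: 'a \<Rightarrow> real. continuous_on UNIV \<psi> \<Longrightarrow> (\<And>x. \<bar>\<psi> x\<bar> \<le> 1) \<Longrightarrow> (\<integral>x. \<psi> x * g x \<partial>lborel) = 0"
  shows "AE x in lborel. g x = 0"
proof (rule AE_zero_if_integrals_zero_closed[OF g])
  fix C :: "'a set" assume C: "closed C"
  show "(\<integral>x. indicator C x *\<^sub>R g x \<partial>lborel) = 0"
  proof (cases "C = {}")
    case False
    define \<psi> where "\<psi> n x = max 0 (1 - real n * infdist x C)" for n x
    have c: "continuous_on UNIV (\<psi> n)" for n
      unfolding \<psi>_def by (intro continuous_intros)
    have b: "\<bar>\<psi> n x\<bar> \<le> 1" for n x
      using infdist_nonneg[of x C] by (auto simp: \<psi>_def max_def)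
    have [measurable]: "\<psi> n \<in> borel_measurable borel" for n
      using c by (rule borel_measurable_continuous_onI)
    have [measurable]: "g \<in> borel_measurable borel" "C \<in> sets borel" using g C by auto
    have "(\<lambda>n. \<integral>x. \<psi> n x * g x \<partial>lborel) \<longlonglongrightarrow> (\<integral>x. indicator C x *\<^sub>R g x \<partial>lborel)"
    proof (rule integral_dominated_convergence[where w = "\<lambda>x. \<bar>g x\<bar>"])
      show "integrable lborel (\<lambda>x. \<bar>g x\<bar>)" using g by simp
      have "(\<lambda>n. \<psi> n x) \<longlonglongrightarrow> indicator C x" for x
      proof (cases "x \<in> C")
        case True
        then have "\<psi> n x = 1" for n by (simp add: \<psi>_def)
        then show ?thesis using True by simp
      next
        case x: False
        then have pos: "infdist x C > 0"
          using C False by (metis in_closed_iff_infdist_zero infdist_nonneg less_eq_real_def)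
        then obtain N :: nat where N: "1 < N * infdist x C"
          using ex_less_of_nat_mult by blast
        have "\<psi> n x = 0" if "n \<ge> N" for n
        proof -
          have "N * infdist x C \<le> n * infdist x C"
            using that pos by (intro mult_right_mono) auto
          then show ?thesis using N by (simp add: \<psi>_def)
        qed
        then show ?thesis
          using x by (intro tendsto_eventually eventually_sequentiallyI[of N]) auto
      qed
      then show "AE x in lborel. (\<lambda>n. \<psi> n x * g x) \<longlonglongrightarrow> indicator C x *\<^sub>R g x"
        by (auto intro!: tendsto_mult)
      show "AE x in lborel. norm (\<psi> n x * g x) \<le> \<bar>g x\<bar>" for n
        using mult_right_mono[OF b] by (auto simp: abs_mult mult_left_le_one_le)
    qed measurable
    then show ?thesis
      using cont[OF c b] by (simp add: LIMSEQ_const_iff)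
  qed simp
qed

lemma integrable_continuous_mult_compact_support:
  fixes g :: "'a::euclidean_space \<Rightarrow> real"
  assumes g: "integrable lborel g" and K: "compact K" "\<And>x. x \<notin> K \<Longrightarrow> g x = 0"
    and \<phi>: "continuous_on UNIV \<phi>"
  shows "integrable lborel (\<lambda>x. \<phi> x * g x)"
proof -
  have [measurable]: "\<phi> \<in> borel_measurable borel" "g \<in> borel_measurable borel"
    using \<phi> g by (auto intro: borel_measurable_continuous_onI)
  have "bounded (\<phi> ` K)"
    using K \<phi> by (intro compact_imp_bounded compact_continuous_image) (auto intro: continuous_on_subset)
  then obtain B where B: "\<And>x. x \<in> K \<Longrightarrow> \<bar>\<phi> x\<bar> \<le> B" by (auto simp: bounded_iff)
  show ?thesis
  proof (rule Bochner_Integration.integrable_bound[where f = "\<lambda>x. B * g x"])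
    have "\<bar>\<phi> x * g x\<bar> \<le> \<bar>B * g x\<bar>" for x
    proof (cases "x \<in> K")
      case True
      then have "\<bar>\<phi> x\<bar> \<le> \<bar>B\<bar>" using B[of x] by simp
      then show ?thesis by (simp add: abs_mult mult_right_mono)
    qed (use K in simp)
    then show "AE x in lborel. norm (\<phi> x * g x) \<le> norm (B * g x)" by simp
  qed (use g in auto)
qed

text \<open>The exponentials \<open>x \<mapsto> exp(a\<cdot>x)\<close> are closed under multiplication and separate points, so by the
  theorem of Stone and Weierstrass their linear combinations approximate every continuous function
  uniformly on \<open>K\<close>. The algebra is described by how it multiplies: \<open>good\<close> functions are orthogonal
  to all exponentials times \<open>g\<close>, and \<open>P\<close> holds for the multipliers that preserve goodness.\<close>

lemma AE_zero_if_laplace_zero: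
  fixes g :: "'a::euclidean_space \<Rightarrow> real"
  assumes g: "integrable lborel g" and K: "compact K" "\<And>x. x \<notin> K \<Longrightarrow> g x = 0"
    and zero: "\<And>a. (\<integral>x. exp (a \<bullet> x) * g x \<partial>lborel) = 0"
  shows "AE x in lborel. g x = 0"
proof (rule AE_zero_if_integrals_zero_continuous[OF g])
  fix \<psi> :: "'a \<Rightarrow> real" assume \<psi>: "continuous_on UNIV \<psi>" "\<And>x. \<bar>\<psi> x\<bar> \<le> 1"
  have int: "integrable lborel (\<lambda>x. \<phi> x * g x)" if "continuous_on UNIV \<phi>" for \<phi>
    using integrable_continuous_mult_compact_support[OF g K that] .
  define good where "good \<phi> \<longleftrightarrow> continuous_on UNIV \<phi> \<and> (\<forall>a. (\<integral>x. (\<phi> x * exp (a \<bullet> x)) * g x \<partial>lborel) = 0)"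
    for \<phi> :: "'a \<Rightarrow> real"
  define P where "P f \<longleftrightarrow> continuous_on UNIV f \<and> (\<forall>\<phi>. good \<phi> \<longrightarrow> good (\<lambda>x. \<phi> x * f x))"
    for f :: "'a \<Rightarrow> real"
  have good1: "good (\<lambda>_. 1)" using zero by (simp add: good_def)
  have good_add: "good (\<lambda>x. \<phi> x + \<rho> x)" if "good \<phi>" "good \<rho>" for \<phi> \<rho>
    unfolding good_def
  proof safe
    show "continuous_on UNIV (\<lambda>x. \<phi> x + \<rho> x)" using that by (auto simp: good_def intro!: continuous_intros)
    fix a
    have "(\<integral>x. ((\<phi> x + \<rho> x) * exp (a \<bullet> x)) * g x \<partial>lborel)
       = (\<integral>x. (\<phi> x * exp (a \<bullet> x)) * g x + (\<rho> x * exp (a \<bullet> x)) * g x \<partial>lborel)"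
      by (simp add: algebra_simps)
    also have "\<dots> = (\<integral>x. (\<phi> x * exp (a \<bullet> x)) * g x \<partial>lborel) + (\<integral>x. (\<rho> x * exp (a \<bullet> x)) * g x \<partial>lborel)"
      using that by (intro Bochner_Integration.integral_add int) (auto simp: good_def intro!: continuous_intros)
    finally show "(\<integral>x. ((\<phi> x + \<rho> x) * exp (a \<bullet> x)) * g x \<partial>lborel) = 0"
      using that by (simp add: good_def)
  qed
  have good_const: "good (\<lambda>x. \<phi> x * c)" if "good \<phi>" for \<phi> c
  proof -
    have "(\<integral>x. (\<phi> x * c * exp (a \<bullet> x)) * g x \<partial>lborel) = c * (\<integral>x. (\<phi> x * exp (a \<bullet> x)) * g x \<partial>lborel)" for a
      by (subst integral_mult_right_zero[symmetric]) (simp add: algebra_simps)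
    then show ?thesis using that by (auto simp: good_def intro!: continuous_intros)
  qed
  have good_exp: "good (\<lambda>x. \<phi> x * exp (b \<bullet> x))" if "good \<phi>" for \<phi> b
  proof -
    have "(\<integral>x. (\<phi> x * exp (b \<bullet> x) * exp (a \<bullet> x)) * g x \<partial>lborel) = (\<integral>x. (\<phi> x * exp ((b + a) \<bullet> x)) * g x \<partial>lborel)" for a
      by (simp add: inner_add_left exp_add algebra_simps)
    then show ?thesis using that by (auto simp: good_def intro!: continuous_intros)
  qed
  have sep: "\<exists>f. P f \<and> f x \<noteq> f y" if "x \<noteq> y" for x y
  proof (intro exI conjI)
    show "P (\<lambda>z. exp ((x - y) \<bullet> z))" using good_exp by (auto simp: P_def intro!: continuous_intros)
    have "(x - y) \<bullet> (x - y) \<noteq> 0" using that by simp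
    then show "exp ((x - y) \<bullet> x) \<noteq> exp ((x - y) \<bullet> y)"
      by (simp add: inner_diff_right)
  qed
  have approx: "\<exists>f. P f \<and> (\<forall>x\<in>K. \<bar>\<psi> x - f x\<bar> < e)" if e: "e > 0" for e
  proof (rule Stone_Weierstrass_HOL[OF K(1)])
    show "P (\<lambda>x. c)" for c using good_const by (auto simp: P_def)
    show "continuous_on K f" if "P f" for f using that by (auto simp: P_def intro: continuous_on_subset)
    show "P (\<lambda>x. f x + f' x)" if "P f \<and> P f'" for f f'
      using that good_add by (auto simp: P_def distrib_left intro!: continuous_intros)
    show "P (\<lambda>x. f x * f' x)" if "P f \<and> P f'" for f f'
      using that unfolding P_def by (auto intro!: continuous_intros simp: mult.assoc[symmetric])
    show "continuous_on K \<psi>" using \<psi> by (auto intro: continuous_on_subset)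
  qed (use sep e in auto)
  have bound: "\<bar>\<integral>x. \<psi> x * g x \<partial>lborel\<bar> \<le> e * (\<integral>x. \<bar>g x\<bar> \<partial>lborel)" if e: "e > 0" for e
  proof -
    obtain f where f: "P f" "\<And>x. x \<in> K \<Longrightarrow> \<bar>\<psi> x - f x\<bar> < e" using approx[OF e] by blast
    have cf: "continuous_on UNIV f" and gf: "good f" using f(1) good1 by (auto simp: P_def)
    have "(\<integral>x. f x * g x \<partial>lborel) = 0" using gf by (auto simp: good_def dest: spec[of _ 0])
    then have "(\<integral>x. \<psi> x * g x \<partial>lborel) = (\<integral>x. \<psi> x * g x - f x * g x \<partial>lborel)"
      using int[OF \<psi>(1)] int[OF cf] by simp
    also have "\<bar>\<dots>\<bar> \<le> (\<integral>x. e * \<bar>g x\<bar> \<partial>lborel)"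
    proof (rule order_trans[OF integral_abs_bound integral_mono])
      show "integrable lborel (\<lambda>x. \<bar>\<psi> x * g x - f x * g x\<bar>)" using int[OF \<psi>(1)] int[OF cf] by auto
      show "integrable lborel (\<lambda>x. e * \<bar>g x\<bar>)" using g by simp
      show "\<bar>\<psi> x * g x - f x * g x\<bar> \<le> e * \<bar>g x\<bar>" for x
      proof (cases "x \<in> K")
        case True
        then have "\<bar>\<psi> x - f x\<bar> \<le> e" using f(2) by force
        then show ?thesis by (simp add: left_diff_distrib[symmetric] abs_mult mult_right_mono)
      qed (use K in simp)
    qed
    finally show ?thesis by simp
  qed
  have lim: "\<bar>\<integral>x. \<psi> x * g x \<partial>lborel\<bar> \<le> 0"
  proof -
    have "((\<lambda>e. e * (\<integral>x. \<bar>g x\<bar> \<partial>lborel)) \<longlongrightarrow> 0 * (\<integral>x. \<bar>g x\<bar> \<partial>lborel)) (at_right 0)"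
      by (intro tendsto_intros)
    moreover have "\<forall>\<^sub>F e in at_right 0. \<bar>\<integral>x. \<psi> x * g x \<partial>lborel\<bar> \<le> e * (\<integral>x. \<bar>g x\<bar> \<partial>lborel)"
      using bound by (auto simp: eventually_at_filter)
    ultimately have "\<bar>\<integral>x. \<psi> x * g x \<partial>lborel\<bar> \<le> 0 * (\<integral>x. \<bar>g x\<bar> \<partial>lborel)"
      by (rule tendsto_lowerbound) simp
    then show ?thesis by simp
  qed
  then show "(\<integral>x. \<psi> x * g x \<partial>lborel) = 0" by simp
qed

text \<open>On the support of \<open>g\<close> the function \<open>b\<close> is bounded, so the integral is an entire function of \<open>l\<close>, the sum of the
  power series whose coefficients are the moments of \<open>b\<close>. It vanishes near \<open>0\<close>, hence all moments vanish.\<close>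

lemma exp_integral_zero_if_zero_near_0:
  fixes g b :: "'a \<Rightarrow> real"
  assumes g: "integrable M g" and b[measurable]: "b \<in> borel_measurable M"
    and B: "\<And>x. x \<in> space M \<Longrightarrow> g x \<noteq> 0 \<Longrightarrow> \<bar>b x\<bar> \<le> B"
    and d: "d > 0" and zero: "\<And>l. \<bar>l\<bar> < d \<Longrightarrow> (\<integral>x. exp (l * b x) * g x \<partial>M) = 0"
  shows "(\<integral>x. exp (l * b x) * g x \<partial>M) = 0"
proof -
  define E where "E l = (\<integral>x. exp (l * b x) * g x \<partial>M)" for l :: real
  define c where "c n = (\<integral>x. b x ^ n * g x \<partial>M) / fact n" for n
  have [measurable]: "g \<in> borel_measurable M" using g by simp
  have bd: "\<bar>b x ^ n * g x\<bar> \<le> \<bar>\<bar>B\<bar> ^ n * g x\<bar>" if "x \<in> space M" for x n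
  proof (cases "g x = 0")
    case False
    then have "\<bar>b x\<bar> \<le> \<bar>B\<bar>" using B[OF that] by simp
    then have "\<bar>b x\<bar> ^ n \<le> \<bar>B\<bar> ^ n" by (rule power_mono) simp
    then show ?thesis by (simp add: abs_mult power_abs mult_right_mono)
  qed simp
  have int: "integrable M (\<lambda>x. b x ^ n * g x)" for n
    by (rule Bochner_Integration.integrable_bound[where f = "\<lambda>x. \<bar>B\<bar> ^ n * g x"]) (use g bd in auto)
  have sums: "(\<lambda>n. c n * l ^ n) sums E l" for l
  proof -
    let ?f = "\<lambda>n x. (l ^ n / fact n) * (b x ^ n * g x)"
    have i: "integrable M (?f n)" for n using int by simp
    have s: "AE x in M. summable (\<lambda>n. norm (?f n x))"
    proof (rule AE_I2)
      fix x
      have "summable (\<lambda>n. norm ((l * b x) ^ n /\<^sub>R fact n) * \<bar>g x\<bar>)"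
        by (intro summable_mult2 summable_norm_exp)
      then show "summable (\<lambda>n. norm (?f n x))"
        by (simp add: abs_mult power_mult_distrib divide_inverse mult_ac)
    qed
    have n: "(\<integral>x. norm (?f n x) \<partial>M) \<le> norm ((l * B) ^ n /\<^sub>R fact n) * (\<integral>x. \<bar>g x\<bar> \<partial>M)" for n
    proof -
      have "(\<integral>x. norm (?f n x) \<partial>M) \<le> (\<integral>x. norm ((l * B) ^ n /\<^sub>R fact n) * \<bar>g x\<bar> \<partial>M)"
      proof (rule integral_mono)
        fix x assume "x \<in> space M"
        from bd[OF this, of n] have "\<bar>l ^ n / fact n\<bar> * \<bar>b x ^ n * g x\<bar> \<le> \<bar>l ^ n / fact n\<bar> * \<bar>\<bar>B\<bar> ^ n * g x\<bar>"
          by (rule mult_left_mono) simp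
        then show "norm (?f n x) \<le> norm ((l * B) ^ n /\<^sub>R fact n) * \<bar>g x\<bar>"
          by (simp add: abs_mult power_mult_distrib divide_inverse power_abs mult_ac)
      qed (use integrable_norm[OF i] g in simp_all)
      then show ?thesis by simp
    qed
    have t: "summable (\<lambda>n. \<integral>x. norm (?f n x) \<partial>M)"
    proof (rule summable_comparison_test')
      show "summable (\<lambda>n. norm ((l * B) ^ n /\<^sub>R fact n) * (\<integral>x. \<bar>g x\<bar> \<partial>M))"
        by (intro summable_mult2 summable_norm_exp)
      show "norm (\<integral>x. norm (?f n x) \<partial>M) \<le> norm ((l * B) ^ n /\<^sub>R fact n) * (\<integral>x. \<bar>g x\<bar> \<partial>M)" if "n \<ge> 0" for n
        using n[of n] integral_nonneg_AE[of "\<lambda>x. norm (?f n x)" M] by auto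
    qed
    have "(\<lambda>n. \<integral>x. ?f n x \<partial>M) sums (\<integral>x. (\<Sum>n. ?f n x) \<partial>M)"
      by (rule sums_integral[OF i s t])
    moreover have "(\<Sum>n. ?f n x) = exp (l * b x) * g x" for x
    proof -
      have "(\<lambda>n. (l * b x) ^ n /\<^sub>R fact n * g x) sums (exp (l * b x) * g x)"
        by (intro sums_mult2 exp_converges)
      then have "(\<lambda>n. ?f n x) sums (exp (l * b x) * g x)"
        by (simp add: power_mult_distrib divide_inverse mult_ac)
      then show ?thesis by (simp add: sums_iff)
    qed
    ultimately show ?thesis by (simp add: c_def E_def mult.commute)
  qed
  have "c m = 0" for m
  proof (rule ccontr)
    assume m: "c m \<noteq> 0"
    have m0: "m > 0"
    proof (rule ccontr)
      assume "\<not> m > 0"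
      then have "c m = E 0" by (simp add: c_def E_def)
      then show False using zero[of 0] d m by (simp add: E_def)
    qed
    obtain s where s: "0 < s" "\<And>z. z \<in> cball 0 s - {0} \<Longrightarrow> E z \<noteq> 0"
      using powser_0_nonzero[of d 0 c E m] sums zero[of 0] d m m0 by (auto simp: E_def)
    define z where "z = min s (d/2)"
    have "z > 0" "z \<le> s" "z < d" using s d by (auto simp: z_def)
    then show False using s(2)[of z] zero[of z] by (simp add: E_def)
  qed
  then show ?thesis using sums[of l] by (simp add: E_def sums_iff)
qed

text \<open>Along every line through a point of the open set the Laplace transform is an entire function,
  so it vanishes on the whole line, and the lines through one point cover the space.\<close>

theorem AE_zero_if_laplace_zero_on_open:
  fixes g :: "'a::euclidean_space \<Rightarrow> real"
  assumes g: "integrable lborel g" and K: "compact K" "\<And>x. x \<notin> K \<Longrightarrow> g x = 0"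
    and U: "open U" "a\<^sub>0 \<in> U"
    and zero: "\<And>a. a \<in> U \<Longrightarrow> (\<integral>x. exp (a \<bullet> x) * g x \<partial>lborel) = 0"
  shows "AE x in lborel. g x = 0"
proof (rule AE_zero_if_laplace_zero[OF g K])
  fix a
  define v where "v = a - a\<^sub>0"
  obtain e where e: "e > 0" "ball a\<^sub>0 e \<subseteq> U" using U by (meson open_contains_ball)
  define G where "G x = exp (a\<^sub>0 \<bullet> x) * g x" for x
  have G: "integrable lborel G" unfolding G_def
    by (intro integrable_continuous_mult_compact_support[OF g K] continuous_intros)
  have E: "(\<integral>x. exp (l * (v \<bullet> x)) * G x \<partial>lborel) = (\<integral>x. exp ((a\<^sub>0 + l *\<^sub>R v) \<bullet> x) * g x \<partial>lborel)" for l
    by (simp add: G_def inner_add_left exp_add mult_ac)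
  obtain B where B: "\<And>x. x \<in> K \<Longrightarrow> norm x \<le> B" using compact_imp_bounded[OF K(1)] by (auto simp: bounded_iff)
  have "(\<integral>x. exp (1 * (v \<bullet> x)) * G x \<partial>lborel) = 0"
  proof (rule exp_integral_zero_if_zero_near_0[OF G, where B = "norm v * B" and d = "e / (norm v + 1)"])
    show "\<bar>v \<bullet> x\<bar> \<le> norm v * B" if "G x \<noteq> 0" for x
    proof -
      have "x \<in> K" using that K by (auto simp: G_def)
      then show ?thesis using Cauchy_Schwarz_ineq2[of v x] B mult_left_mono[of "norm x" B "norm v"] by fastforce
    qed
    show "0 < e / (norm v + 1)" using e by (simp add: add_nonneg_pos)
    fix l assume "\<bar>l\<bar> < e / (norm v + 1)"
    then have "\<bar>l\<bar> * (norm v + 1) < e" by (simp add: pos_less_divide_eq add_nonneg_pos)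
    then have "norm (l *\<^sub>R v) < e" by (simp add: distrib_left)
    then have "a\<^sub>0 + l *\<^sub>R v \<in> U" using e by (auto simp: dist_norm)
    then show "(\<integral>x. exp (l * (v \<bullet> x)) * G x \<partial>lborel) = 0" unfolding E by (rule zero)
  qed simp
  then show "(\<integral>x. exp (a \<bullet> x) * g x \<partial>lborel) = 0" unfolding E by (simp add: v_def)
qed

lemma integrable_exp_mult_compact_support:
  fixes g :: "'a::euclidean_space \<Rightarrow> complex"
  assumes g: "integrable lborel g" and K: "compact K" "\<And>x. x \<notin> K \<Longrightarrow> g x = 0"
  shows "integrable lborel (\<lambda>x. complex_of_real (exp (a \<bullet> x)) * g x)"
proof (rule Bochner_Integration.integrable_bound)
  show "integrable lborel (\<lambda>x. exp (a \<bullet> x) * norm (g x))"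
    by (rule integrable_continuous_mult_compact_support[OF _ K(1)])
      (use g K(2) in \<open>auto intro!: continuous_intros\<close>)
  show "(\<lambda>x. complex_of_real (exp (a \<bullet> x)) * g x) \<in> borel_measurable lborel"
    using g by measurable
qed (simp add: norm_mult)

lemma AE_zero_if_complex_laplace_zero_on_open:
  fixes g :: "'a::euclidean_space \<Rightarrow> complex"
  assumes g: "integrable lborel g" and K: "compact K" "\<And>x. x \<notin> K \<Longrightarrow> g x = 0"
    and U: "open U" "a\<^sub>0 \<in> U"
    and zero: "\<And>a. a \<in> U \<Longrightarrow> (\<integral>x. complex_of_real (exp (a \<bullet> x)) * g x \<partial>lborel) = 0"
  shows "AE x in lborel. g x = 0"
proof -
  note int = integrable_exp_mult_compact_support[OF g K]
  have part: "AE x in lborel. L (g x) = 0"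
    if L: "bounded_linear L" "\<And>r z. L (complex_of_real r * z) = r * L z" for L :: "complex \<Rightarrow> real"
  proof (rule AE_zero_if_laplace_zero_on_open[OF _ K(1) _ U])
    show "integrable lborel (\<lambda>x. L (g x))" by (rule integrable_bounded_linear[OF L(1) g])
    show "L (g x) = 0" if "x \<notin> K" for x using K(2)[OF that] L(2)[of 0 0] by simp
    show "(\<integral>x. exp (a \<bullet> x) * L (g x) \<partial>lborel) = 0" if "a \<in> U" for a
      using integral_bounded_linear[OF L(1) int, of a] zero[OF that] L(2)[of 0 0] by (simp add: L(2))
  qed
  show ?thesis
    using part[OF bounded_linear_Re] part[OF bounded_linear_Im] by (auto simp: complex_eq_iff)
qed

lemma continuous_on_laplace:
  fixes h :: "real \<Rightarrow> complex"
  assumes h: "integrable lborel h" and r: "\<And>c. \<bar>c\<bar> > r \<Longrightarrow> h c = 0" "r > 0"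
  shows "continuous_on UNIV (\<lambda>\<eta>. \<integral>c. complex_of_real (exp (\<eta> * c)) * h c \<partial>lborel)"
proof (intro continuous_at_imp_continuous_on ballI)
  fix \<eta> :: real
  show "isCont (\<lambda>\<eta>. \<integral>c. complex_of_real (exp (\<eta> * c)) * h c \<partial>lborel) \<eta>"
    unfolding continuous_at_sequentially comp_def
  proof safe
    fix X :: "nat \<Rightarrow> real" assume X: "X \<longlonglongrightarrow> \<eta>"
    obtain B where B: "\<And>n. \<bar>X n\<bar> \<le> B" using convergent_imp_Bseq[OF convergentI[OF X]] by (auto simp: Bseq_def)
    have [measurable]: "h \<in> borel_measurable borel" using h by simp
    show "(\<lambda>n. \<integral>c. complex_of_real (exp (X n * c)) * h c \<partial>lborel) \<longlonglongrightarrow> (\<integral>c. complex_of_real (exp (\<eta> * c)) * h c \<partial>lborel)"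
    proof (rule integral_dominated_convergence[where w = "\<lambda>c. exp (B * r) * norm (h c)"])
      show "AE c in lborel. norm (complex_of_real (exp (X n * c)) * h c) \<le> exp (B * r) * norm (h c)" for n
      proof (rule AE_I2)
        fix c
        show "norm (complex_of_real (exp (X n * c)) * h c) \<le> exp (B * r) * norm (h c)"
        proof (cases "h c = 0")
          case False
          then have "\<bar>c\<bar> \<le> r" using r(1)[of c] by force
          have "X n * c \<le> \<bar>X n\<bar> * \<bar>c\<bar>" by (metis abs_ge_self abs_mult)
          also have "\<dots> \<le> B * r" using B[of n] \<open>\<bar>c\<bar> \<le> r\<close> by (intro mult_mono) auto
          finally show ?thesis by (simp add: norm_mult mult_right_mono)
        qed simp
      qed
      show "AE c in lborel. (\<lambda>n. complex_of_real (exp (X n * c)) * h c) \<longlonglongrightarrow> complex_of_real (exp (\<eta> * c)) * h c"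
        using X by (intro AE_I2 tendsto_intros)
    qed (use h in auto)
  qed
qed

section \<open>Laplace transforms that decay too fast\<close>

text \<open>Expanding \<open>1 - exp(-exp(p(b-t)))\<close> in powers of \<open>exp(p(b-t))\<close> expresses the left-hand side through
  the values of the transform at the multiples \<open>p, 2p, 3p, \<dots>\<close>, all of which are controlled by
  the decay hypothesis. For \<open>p \<rightarrow> \<infinity>\<close> the double exponential is a sharp cut-off at \<open>b = t\<close>.\<close>

lemma exp_transform_double_exponential_bound:
  fixes g b :: "'a \<Rightarrow> real"
  assumes g: "integrable M g" and b[measurable]: "b \<in> borel_measurable M"
    and B: "\<And>x. x \<in> space M \<Longrightarrow> g x \<noteq> 0 \<Longrightarrow> b x \<le> B"
    and decay: "\<And>p. p > 0 \<Longrightarrow> \<bar>\<integral>x. exp (p * b x) * g x \<partial>M\<bar> \<le> C * exp (p * m)"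
    and p: "p > 0"
  shows "\<bar>\<integral>x. (1 - exp (- exp (p * (b x - t)))) * g x \<partial>M\<bar> \<le> C * (exp (p * (m - t)) * exp (exp (p * (m - t))))"
proof -
  have [measurable]: "g \<in> borel_measurable M" using g by simp
  have tail: "(u::real) ^ Suc k / fact (Suc k) \<le> u * (u ^ k /\<^sub>R fact k)" if "u \<ge> 0" for u k
  proof -
    have "u ^ Suc k / fact (Suc k) \<le> u ^ Suc k / fact k"
      using that by (intro divide_left_mono fact_mono) auto
    then show ?thesis by (simp add: divide_inverse mult_ac)
  qed
  have sum_tail: "summable (\<lambda>k. (u::real) ^ Suc k / fact (Suc k))" if "u \<ge> 0" for u
    using summable_Suc_iff[of "\<lambda>k. u ^ k / fact k"] summable_exp[of u] by (simp add: divide_inverse mult.commute)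
  let ?f = "\<lambda>k x. (-1) ^ k * (exp (p * (b x - t)) ^ Suc k / fact (Suc k)) * g x"
  have f_eq: "?f k x = ((-1) ^ k / fact (Suc k) * exp (- (real (Suc k) * p * t))) * (exp (real (Suc k) * p * b x) * g x)" for k x
  proof -
    have "exp (p * (b x - t)) ^ Suc k = exp (real (Suc k) * p * b x + - (real (Suc k) * p * t))"
      unfolding exp_of_nat_mult[symmetric] by (simp add: algebra_simps)
    then show ?thesis unfolding exp_add by simp
  qed
  have bd: "norm (?f k x) \<le> exp (p * (B - t)) ^ Suc k / fact (Suc k) * \<bar>g x\<bar>" if "x \<in> space M" for k x
  proof (cases "g x = 0")
    case False
    then have "exp (p * (b x - t)) \<le> exp (p * (B - t))" using B[OF that] p by simp
    then have "exp (p * (b x - t)) ^ Suc k / fact (Suc k) \<le> exp (p * (B - t)) ^ Suc k / fact (Suc k)"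
      by (intro divide_right_mono power_mono) auto
    from mult_right_mono[OF this abs_ge_zero[of "g x"]]
    show ?thesis by (simp add: abs_mult del: power_Suc fact_Suc)
  qed simp
  have int: "integrable M (?f k)" for k
    by (rule Bochner_Integration.integrable_bound[where f = "\<lambda>x. exp (p * (B - t)) ^ Suc k / fact (Suc k) * \<bar>g x\<bar>"])
      (use g bd[of _ k] in \<open>auto simp del: power_Suc fact_Suc simp: abs_mult intro!: AE_I2\<close>)
  have s: "AE x in M. summable (\<lambda>k. norm (?f k x))"
  proof (rule AE_I2)
    fix x
    have "summable (\<lambda>k. exp (p * (b x - t)) ^ Suc k / fact (Suc k) * \<bar>g x\<bar>)"
      by (intro summable_mult2 sum_tail) simp
    then show "summable (\<lambda>k. norm (?f k x))" by (simp add: abs_mult del: power_Suc fact_Suc)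
  qed
  have n: "summable (\<lambda>k. \<integral>x. norm (?f k x) \<partial>M)"
  proof (rule summable_comparison_test')
    show "summable (\<lambda>k. exp (p * (B - t)) ^ Suc k / fact (Suc k) * (\<integral>x. \<bar>g x\<bar> \<partial>M))"
      by (intro summable_mult2 sum_tail) simp
    show "norm (\<integral>x. norm (?f k x) \<partial>M) \<le> exp (p * (B - t)) ^ Suc k / fact (Suc k) * (\<integral>x. \<bar>g x\<bar> \<partial>M)" if "k \<ge> 0" for k
    proof -
      have "norm (\<integral>x. norm (?f k x) \<partial>M) = (\<integral>x. norm (?f k x) \<partial>M)"
        using integral_nonneg_AE[of "\<lambda>x. norm (?f k x)" M] by auto
      also have "\<dots> \<le> (\<integral>x. exp (p * (B - t)) ^ Suc k / fact (Suc k) * \<bar>g x\<bar> \<partial>M)"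
        using integrable_norm[OF int[of k]] g bd[of _ k] by (intro integral_mono) (simp_all del: power_Suc fact_Suc real_norm_def)
      finally show ?thesis by (simp del: power_Suc fact_Suc)
    qed
  qed
  have "(\<lambda>k. \<integral>x. ?f k x \<partial>M) sums (\<integral>x. (\<Sum>k. ?f k x) \<partial>M)"
    by (rule sums_integral[OF int s n])
  moreover have "(\<Sum>k. ?f k x) = (1 - exp (- exp (p * (b x - t)))) * g x" for x
  proof -
    define u where "u = exp (p * (b x - t))"
    have "(\<lambda>k. (- u) ^ k /\<^sub>R fact k) sums exp (- u)" by (rule exp_converges)
    then have "(\<lambda>k. (- u) ^ Suc k /\<^sub>R fact (Suc k)) sums (exp (- u) - 1)"
      by (subst sums_Suc_iff) simp
    then have "(\<lambda>k. - ((- u) ^ Suc k /\<^sub>R fact (Suc k)) * g x) sums (- (exp (- u) - 1) * g x)"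
      by (intro sums_mult2 sums_minus)
    moreover have "- ((- u) ^ Suc k /\<^sub>R fact (Suc k)) = (-1) ^ k * (u ^ Suc k / fact (Suc k))" for k
      using power_minus[of u "Suc k"] by (simp add: divide_inverse)
    ultimately have "(\<lambda>k. ?f k x) sums ((1 - exp (- u)) * g x)"
      by (simp add: u_def)
    then show ?thesis by (simp add: sums_iff u_def)
  qed
  ultimately have sums: "(\<lambda>k. \<integral>x. ?f k x \<partial>M) sums (\<integral>x. (1 - exp (- exp (p * (b x - t)))) * g x \<partial>M)"
    by (simp only:)
  define q where "q = exp (p * (m - t))"
  have C: "C \<ge> 0"
  proof -
    have "0 \<le> C * exp (1 * m)" using decay[of 1] by linarith
    then show ?thesis by (simp add: zero_le_mult_iff)
  qed
  have fb: "\<bar>\<integral>x. ?f k x \<partial>M\<bar> \<le> C * (q * (q ^ k /\<^sub>R fact k))" for k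
  proof -
    have "\<bar>\<integral>x. ?f k x \<partial>M\<bar> = 1 / fact (Suc k) * exp (- (real (Suc k) * p * t)) * \<bar>\<integral>x. exp (real (Suc k) * p * b x) * g x \<partial>M\<bar>"
      unfolding f_eq by (simp add: abs_mult del: fact_Suc of_nat_Suc)
    also have "\<dots> \<le> 1 / fact (Suc k) * exp (- (real (Suc k) * p * t)) * (C * exp (real (Suc k) * p * m))"
      using p by (intro mult_left_mono decay) auto
    also have "\<dots> = C * (exp (- (real (Suc k) * p * t) + real (Suc k) * p * m) / fact (Suc k))"
      unfolding exp_add by simp
    also have "exp (- (real (Suc k) * p * t) + real (Suc k) * p * m) = q ^ Suc k"
      unfolding q_def exp_of_nat_mult[symmetric] by (simp add: algebra_simps)
    also have "C * (q ^ Suc k / fact (Suc k)) \<le> C * (q * (q ^ k /\<^sub>R fact k))"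
      using C by (intro mult_left_mono tail) (auto simp: q_def)
    finally show ?thesis .
  qed
  have rs: "(\<lambda>k. C * (q * (q ^ k /\<^sub>R fact k))) sums (C * (q * exp q))"
    by (intro sums_mult exp_converges)
  have "summable (\<lambda>k. \<bar>\<integral>x. ?f k x \<partial>M\<bar>)"
    by (rule summable_comparison_test'[OF sums_summable[OF rs], of 0]) (use fb in simp)
  then have "\<bar>\<Sum>k. \<integral>x. ?f k x \<partial>M\<bar> \<le> (\<Sum>k. \<bar>\<integral>x. ?f k x \<partial>M\<bar>)"
    by (rule summable_rabs)
  also have "\<dots> \<le> C * (q * exp q)"
    using suminf_le[OF fb \<open>summable (\<lambda>k. \<bar>\<integral>x. ?f k x \<partial>M\<bar>)\<close> sums_summable[OF rs]] rs by (simp add: sums_iff)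
  finally show ?thesis using sums by (simp add: sums_iff q_def)
qed

text \<open>As \<open>p \<rightarrow> \<infinity>\<close> the function \<open>1 - exp(-exp(p(b-t)))\<close> tends to \<open>1\<close> where \<open>b > t\<close> and to \<open>0\<close> where
  \<open>b < t\<close>, while its integral against \<open>g\<close> tends to \<open>0\<close> for \<open>t > m\<close>. Where \<open>b = t\<close> the limit is
  \<open>1 - 1/e\<close>; this spurious weight is removed by a second limit, along levels that increase
  strictly to \<open>t\<close>.\<close>

lemma integral_superlevel_zero_if_exp_transform_decays:
  fixes g b :: "'a \<Rightarrow> real"
  assumes g: "integrable M g" and b[measurable]: "b \<in> borel_measurable M"
    and B: "\<And>x. x \<in> space M \<Longrightarrow> g x \<noteq> 0 \<Longrightarrow> b x \<le> B"
    and decay: "\<And>p. p > 0 \<Longrightarrow> \<bar>\<integral>x. exp (p * b x) * g x \<partial>M\<bar> \<le> C * exp (p * m)"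
    and t: "m < t"
  shows "(\<integral>x. indicator {x. t \<le> b x} x * g x \<partial>M) = 0"
proof -
  have [measurable]: "g \<in> borel_measurable M" using g by simp
  define w :: "real \<Rightarrow> real \<Rightarrow> real" where "w t y = (if y > t then 1 else if y = t then 1 - exp (-1) else 0)" for t y
  have [measurable]: "w t \<in> borel_measurable borel" for t unfolding w_def by measurable
  have w01: "\<bar>w t y\<bar> \<le> 1" for t y by (auto simp: w_def)
  have zero: "(\<integral>x. w t (b x) * g x \<partial>M) = 0" if t: "m < t" for t
  proof -
    let ?s = "\<lambda>n x. (1 - exp (- exp (real (Suc n) * (b x - t)))) * g x"
    have lim1: "(\<lambda>n. \<integral>x. ?s n x \<partial>M) \<longlonglongrightarrow> (\<integral>x. w t (b x) * g x \<partial>M)"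
    proof (rule integral_dominated_convergence[where w = "\<lambda>x. \<bar>g x\<bar>"])
      have "(\<lambda>n. 1 - exp (- exp (real (Suc n) * d))) \<longlonglongrightarrow> (if 0 < d then 1 else if d = 0 then 1 - exp (-1) else 0)" for d :: real
      proof -
        consider "d > 0" | "d = 0" | "d < 0" by linarith
        then show ?thesis
          by cases (simp_all, real_asymp+)
      qed
      moreover have "w t y = (if 0 < y - t then 1 else if y - t = 0 then 1 - exp (-1) else 0)" for y
        by (simp add: w_def)
      ultimately have "(\<lambda>n. 1 - exp (- exp (real (Suc n) * (y - t)))) \<longlonglongrightarrow> w t y" for y
        by (simp only:)
      then show "AE x in M. (\<lambda>n. ?s n x) \<longlonglongrightarrow> w t (b x) * g x"
        by (intro AE_I2 tendsto_mult tendsto_const)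
      show "AE x in M. norm (?s n x) \<le> \<bar>g x\<bar>" for n
        by (auto simp: abs_mult intro!: mult_left_le_one_le)
    qed (use g in auto)
    have lim2: "(\<lambda>n. \<integral>x. ?s n x \<partial>M) \<longlonglongrightarrow> 0"
    proof (rule Lim_null_comparison)
      show "\<forall>\<^sub>F n in sequentially. norm (\<integral>x. ?s n x \<partial>M) \<le> C * (exp (real (Suc n) * (m - t)) * exp (exp (real (Suc n) * (m - t))))"
        using exp_transform_double_exponential_bound[OF g b B decay] by (auto intro!: always_eventually)
      show "(\<lambda>n. C * (exp (real (Suc n) * (m - t)) * exp (exp (real (Suc n) * (m - t))))) \<longlonglongrightarrow> 0"
      proof (rule tendsto_mult_right_zero)
        define d where "d = t - m"
        have d: "d > 0" "m - t = - d" using t by (auto simp: d_def)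
        show "(\<lambda>n. exp (real (Suc n) * (m - t)) * exp (exp (real (Suc n) * (m - t)))) \<longlonglongrightarrow> 0"
          unfolding d(2) using d(1) by real_asymp
      qed
    qed
    show ?thesis using LIMSEQ_unique[OF lim1 lim2] .
  qed
  \<comment> \<open>These levels lie in \<open>(m,t)\<close>, where the first limit applies, and never equal \<open>t\<close>.\<close>
  define s where "s n = t - (t - m) / real (n + 2)" for n
  have s: "m < s n" "s n < t" for n
  proof -
    have "(t - m) / real (n + 2) < t - m" using t by (simp add: divide_less_eq)
    then show "m < s n" by (simp add: s_def)
    show "s n < t" using t by (simp add: s_def)
  qed
  have slim: "s \<longlonglongrightarrow> t" unfolding s_def by real_asymp
  have "(\<lambda>n. \<integral>x. w (s n) (b x) * g x \<partial>M) \<longlonglongrightarrow> (\<integral>x. indicator {x. t \<le> b x} x * g x \<partial>M)"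
  proof (rule integral_dominated_convergence[where w = "\<lambda>x. \<bar>g x\<bar>"])
    have "(\<lambda>n. w (s n) y) \<longlonglongrightarrow> (if t \<le> y then 1 else 0)" for y
    proof (cases "t \<le> y")
      case True
      then have "w (s n) y = 1" for n using s(2)[of n] by (simp add: w_def)
      then show ?thesis using True by simp
    next
      case False
      then have "\<forall>\<^sub>F n in sequentially. y < s n" using slim by (intro order_tendstoD) auto
      then have "\<forall>\<^sub>F n in sequentially. w (s n) y = 0" by eventually_elim (simp add: w_def)
      then show ?thesis using False by (simp add: tendsto_eventually)
    qed
    then have "(\<lambda>n. w (s n) (b x)) \<longlonglongrightarrow> indicator {x. t \<le> b x} x" for x
    proof (cases "t \<le> b x")
      case True
      with \<open>\<And>y. (\<lambda>n. w (s n) y) \<longlonglongrightarrow> (if t \<le> y then 1 else 0)\<close>[of "b x"] show ?thesis by simp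
    next
      case False
      with \<open>\<And>y. (\<lambda>n. w (s n) y) \<longlonglongrightarrow> (if t \<le> y then 1 else 0)\<close>[of "b x"] show ?thesis by simp
    qed
    then show "AE x in M. (\<lambda>n. w (s n) (b x) * g x) \<longlonglongrightarrow> indicator {x. t \<le> b x} x * g x"
      by (intro AE_I2 tendsto_mult tendsto_const)
    show "AE x in M. norm (w (s n) (b x) * g x) \<le> \<bar>g x\<bar>" for n
      using w01 by (auto simp: abs_mult intro!: mult_left_le_one_le)
    show "(\<lambda>x. w (s n) (b x) * g x) \<in> borel_measurable M" for n by measurable
    have "(\<lambda>x. indicator {x \<in> space M. t \<le> b x} x * g x) \<in> borel_measurable M" by measurable
    then show "(\<lambda>x. indicator {x. t \<le> b x} x * g x) \<in> borel_measurable M"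
      by (rule measurable_cong[THEN iffD1, rotated]) (simp add: indicator_def)
  qed (use g in auto)
  then show ?thesis using zero[OF s(1)] by (simp add: LIMSEQ_const_iff)
qed

text \<open>With \<open>b \<ge> A\<close> on the support of \<open>g\<close>, a nonzero transform cannot have a smaller exponential order
  than \<open>exp(pA)\<close>: under the decay hypothesis all superlevel sets
  \<open>{t \<le> b}\<close> with \<open>t \<ge> A\<close> carry zero total \<open>g\<close>-mass, and the layer-cake formula
  \<open>exp(l b) = exp(l A) + \<integral> 1[A \<le> t \<le> b] l exp(l t) dt\<close> recovers the transform from these masses.\<close>

theorem exp_transform_zero_if_decays:
  fixes g b :: "'a \<Rightarrow> real"
  assumes M: "sigma_finite_measure M"
    and g: "integrable M g" and b[measurable]: "b \<in> borel_measurable M"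
    and A: "\<And>x. x \<in> space M \<Longrightarrow> g x \<noteq> 0 \<Longrightarrow> A \<le> b x"
    and B: "\<And>x. x \<in> space M \<Longrightarrow> g x \<noteq> 0 \<Longrightarrow> b x \<le> B"
    and decay: "\<And>p. p > 0 \<Longrightarrow> \<bar>\<integral>x. exp (p * b x) * g x \<partial>M\<bar> \<le> C * exp (p * m)"
    and m: "m < A"
  shows "(\<integral>x. exp (l * b x) * g x \<partial>M) = 0"
proof -
  have [measurable]: "g \<in> borel_measurable M" using g by simp
  interpret P: pair_sigma_finite M "lborel :: real measure"
    using M by (simp add: pair_sigma_finite_def lborel.sigma_finite_measure_axioms)
  have level: "(\<integral>x. indicator {x. t \<le> b x} x * g x \<partial>M) = 0" if "A \<le> t" for t
    using integral_superlevel_zero_if_exp_transform_decays[OF g b B decay, of t] m that by simp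
  have "(\<integral>x. g x \<partial>M) = (\<integral>x. indicator {x. A \<le> b x} x * g x \<partial>M)"
    using A by (intro Bochner_Integration.integral_cong) (auto simp: indicator_def)
  then have g0: "(\<integral>x. g x \<partial>M) = 0" using level[of A] by simp
  \<comment> \<open>The integrand of the layer-cake formula; \<open>t \<le> B\<close> makes it integrable on the product space.\<close>
  define F where "F = (\<lambda>(x, t). (if A \<le> t \<and> t \<le> B \<and> t \<le> b x then l * exp (l * t) else 0) * g x)"
  have [measurable]: "F \<in> borel_measurable (M \<Otimes>\<^sub>M lborel)" unfolding F_def by measurable
  define K where "K = \<bar>l\<bar> * exp (\<bar>l\<bar> * (\<bar>A\<bar> + \<bar>B\<bar>))"
  have K: "\<bar>l * exp (l * t)\<bar> \<le> K" if "A \<le> t" "t \<le> B" for t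
  proof -
    have "l * t \<le> \<bar>l\<bar> * \<bar>t\<bar>" by (metis abs_ge_self abs_mult)
    also have "\<dots> \<le> \<bar>l\<bar> * (\<bar>A\<bar> + \<bar>B\<bar>)" using that by (intro mult_left_mono) auto
    finally show ?thesis by (auto simp: K_def abs_mult intro!: mult_left_mono)
  qed
  have K0: "K \<ge> 0" by (simp add: K_def)
  have iF: "integrable (M \<Otimes>\<^sub>M lborel) F"
  proof (rule P.Fubini_integrable)
    have bnd: "norm (F (x, t)) \<le> indicator {A..B} t * (K * \<bar>g x\<bar>)" for x t
      using K[of t] K0 by (auto simp: F_def indicator_def abs_mult intro!: mult_right_mono)
    have i: "integrable lborel (\<lambda>t. indicator {A..B} t * (K * \<bar>g x\<bar>))" for x
      by (intro integrable_mult_left) (simp add: integrable_indicator_iff emeasure_lborel_Icc_eq)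
    show "AE x in M. integrable lborel (\<lambda>t. F (x, t))"
    proof (rule AE_I2)
      fix x assume "x \<in> space M"
      then have [measurable]: "(\<lambda>t. F (x, t)) \<in> borel_measurable lborel" by measurable
      show "integrable lborel (\<lambda>t. F (x, t))"
        by (rule Bochner_Integration.integrable_bound[OF i]) (use bnd K0 in \<open>auto intro!: AE_I2 order_trans[OF bnd]\<close>)
    qed
    show "integrable M (\<lambda>x. \<integral>t. norm (F (x, t)) \<partial>lborel)"
    proof (rule Bochner_Integration.integrable_bound)
      show "integrable M (\<lambda>x. measure lborel {A..B} * (K * \<bar>g x\<bar>))" using g by simp
      show "(\<lambda>x. \<integral>t. norm (F (x, t)) \<partial>lborel) \<in> borel_measurable M" by measurable
      have "(\<integral>t. norm (F (x, t)) \<partial>lborel) \<le> (\<integral>t. indicator {A..B} t * (K * \<bar>g x\<bar>) \<partial>lborel)" for x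
        by (rule integral_mono_AE'[OF i]) (use bnd K0 in auto)
      then have "(\<integral>t. norm (F (x, t)) \<partial>lborel) \<le> measure lborel {A..B} * (K * \<bar>g x\<bar>)" for x by simp
      then show "AE x in M. norm (\<integral>t. norm (F (x, t)) \<partial>lborel) \<le> norm (measure lborel {A..B} * (K * \<bar>g x\<bar>))"
        using K0 by (auto intro!: AE_I2)
    qed
  qed measurable
  have inner: "(\<integral>t. F (x, t) \<partial>lborel) = (exp (l * b x) - exp (l * A)) * g x" if x: "x \<in> space M" for x
  proof (cases "g x = 0")
    case False
    then have Ab: "A \<le> b x" "b x \<le> B" using A B x by auto
    have "(\<integral>t. F (x, t) \<partial>lborel) = (\<integral>t. (l * exp (l * t)) * indicator {A..b x} t * g x \<partial>lborel)"
      using Ab by (intro Bochner_Integration.integral_cong) (auto simp: F_def indicator_def)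
    also have "\<dots> = (\<integral>t. (l * exp (l * t)) * indicator {A..b x} t \<partial>lborel) * g x"
      by simp
    also have "(\<integral>t. (l * exp (l * t)) * indicator {A..b x} t \<partial>lborel) = exp (l * b x) - exp (l * A)"
      by (rule integral_FTC_Icc_real[where F = "\<lambda>t. exp (l * t)"])
         (use Ab in \<open>auto intro!: derivative_eq_intros continuous_intros\<close>)
    finally show ?thesis .
  qed (simp add: F_def)
  have "(\<integral>x. (exp (l * b x) - exp (l * A)) * g x \<partial>M) = (\<integral>x. (\<integral>t. F (x, t) \<partial>lborel) \<partial>M)"
    by (intro Bochner_Integration.integral_cong) (auto simp: inner)
  also have "\<dots> = (\<integral>t. (\<integral>x. F (x, t) \<partial>M) \<partial>lborel)"
    using P.Fubini_integral[of "\<lambda>x t. F (x, t)"] iF by simp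
  also have "\<dots> = (\<integral>t. 0 \<partial>(lborel :: real measure))"
  proof (rule Bochner_Integration.integral_cong[OF refl])
    fix t
    have "(\<integral>x. F (x, t) \<partial>M) = (\<integral>x. (if A \<le> t \<and> t \<le> B then l * exp (l * t) else 0) * (indicator {x. t \<le> b x} x * g x) \<partial>M)"
      by (intro Bochner_Integration.integral_cong) (auto simp: F_def indicator_def)
    also have "\<dots> = 0" using level[of t] by auto
    finally show "(\<integral>x. F (x, t) \<partial>M) = 0" .
  qed
  finally have "(\<integral>x. exp (l * b x) * g x - exp (l * A) * g x \<partial>M) = 0" by (simp add: algebra_simps)
  moreover have "integrable M (\<lambda>x. exp (l * b x) * g x)"
  proof (rule Bochner_Integration.integrable_bound[where f = "\<lambda>x. exp (\<bar>l\<bar> * (\<bar>A\<bar> + \<bar>B\<bar>)) * g x"])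
    have "exp (l * b x) * \<bar>g x\<bar> \<le> exp (\<bar>l\<bar> * (\<bar>A\<bar> + \<bar>B\<bar>)) * \<bar>g x\<bar>" if "x \<in> space M" for x
    proof (cases "g x = 0")
      case False
      have "l * b x \<le> \<bar>l\<bar> * \<bar>b x\<bar>" by (metis abs_ge_self abs_mult)
      also have "\<dots> \<le> \<bar>l\<bar> * (\<bar>A\<bar> + \<bar>B\<bar>)" using A[OF that False] B[OF that False] by (intro mult_left_mono) auto
      finally show ?thesis by (auto intro!: mult_right_mono)
    qed simp
    then show "AE x in M. norm (exp (l * b x) * g x) \<le> norm (exp (\<bar>l\<bar> * (\<bar>A\<bar> + \<bar>B\<bar>)) * g x)"
      by (auto simp: abs_mult)
  qed (use g in auto)
  ultimately show ?thesis using g g0 by simp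
qed

section \<open>The Yukawa kernel and the exterior maximum principle\<close>

definition yukawa :: "real \<Rightarrow> 'a::euclidean_space \<Rightarrow> real" where
  "yukawa p z = exp (- (p * norm z)) / norm z"

text \<open>The second derivative of the Yukawa kernel at \<open>z\<close> in the unit direction \<open>e\<close>: the radial second
  derivative weighted with the squared cosine between \<open>z\<close> and \<open>e\<close>, plus \<open>1/|z|\<close> times the radial first
  derivative weighted with the squared sine.\<close>

definition yukawa_d2 :: "real \<Rightarrow> 'a::euclidean_space \<Rightarrow> 'a \<Rightarrow> real" where
  "yukawa_d2 p e z = exp (- (p * norm z)) *
     ((p\<^sup>2 / norm z + 2 * p / norm z ^ 2 + 2 / norm z ^ 3) * ((z \<bullet> e) / norm z)\<^sup>2
      - (p / norm z ^ 2 + 1 / norm z ^ 3) * (1 - ((z \<bullet> e) / norm z)\<^sup>2))"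

text \<open>Second differences stand in for second derivatives. They pass through integrals without any
  regularity theory, and they are nonpositive at an interior maximum.\<close>

definition second_difference :: "('a::euclidean_space \<Rightarrow> real) \<Rightarrow> 'a \<Rightarrow> real \<Rightarrow> 'a \<Rightarrow> real" where
  "second_difference u e t x = (u (x + t *\<^sub>R e) + u (x - t *\<^sub>R e) - 2 * u x) / t\<^sup>2"

definition discrete_laplacian :: "('a::euclidean_space \<Rightarrow> real) \<Rightarrow> real \<Rightarrow> 'a \<Rightarrow> real" where
  "discrete_laplacian u t x = (\<Sum>e\<in>Basis. second_difference u e t x)"

lemma norm_line_has_real_derivative:
  fixes z e :: "'a::euclidean_space"
  assumes e: "norm e = 1" and nz: "z + s *\<^sub>R e \<noteq> 0"
  shows "((\<lambda>s. norm (z + s *\<^sub>R e)) has_real_derivative ((z + s *\<^sub>R e) \<bullet> e) / norm (z + s *\<^sub>R e)) (at s)"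
proof -
  have ee: "e \<bullet> e = 1" using e by (simp add: norm_eq_sqrt_inner)
  have eq: "norm (z + s *\<^sub>R e) = sqrt (z \<bullet> z + 2 * s * (z \<bullet> e) + s\<^sup>2)" for s
    unfolding norm_eq_sqrt_inner by (simp add: inner_add_left inner_add_right ee inner_commute power2_eq_square algebra_simps)
  have half: "(2 * c + 2 * s) * (inverse r / 2) = (c + s) / r" for c r s :: real
    by (cases "r = 0") (simp_all add: field_simps)
  have pos: "0 < z \<bullet> z + 2 * s * (z \<bullet> e) + s\<^sup>2"
    using nz eq[of s] by (metis norm_le_zero_iff real_sqrt_gt_0_iff not_le)
  have "((\<lambda>s. sqrt (z \<bullet> z + 2 * s * (z \<bullet> e) + s\<^sup>2)) has_real_derivative
      (2 * (z \<bullet> e) + 2 * s) * (inverse (sqrt (z \<bullet> z + 2 * s * (z \<bullet> e) + s\<^sup>2)) / 2)) (at s)"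
    using pos by (auto intro!: derivative_eq_intros)
  then have "((\<lambda>s. sqrt (z \<bullet> z + 2 * s * (z \<bullet> e) + s\<^sup>2)) has_real_derivative
      ((z \<bullet> e) + s) / sqrt (z \<bullet> z + 2 * s * (z \<bullet> e) + s\<^sup>2)) (at s)"
    by (rule DERIV_cong) (rule half)
  moreover have "(z + s *\<^sub>R e) \<bullet> e = z \<bullet> e + s" by (simp add: inner_add_left ee)
  ultimately show ?thesis unfolding eq by simp
qed

lemma yukawa_profile_derivatives:
  fixes n p :: real
  assumes n: "n > 0"
  shows "((\<lambda>n. exp (- (p * n)) / n) has_real_derivative - exp (- (p * n)) * (p / n + 1 / n ^ 2)) (at n)"
    and "((\<lambda>n. - exp (- (p * n)) * (p / n + 1 / n ^ 2)) has_real_derivative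
       exp (- (p * n)) * (p\<^sup>2 / n + 2 * p / n ^ 2 + 2 / n ^ 3)) (at n)"
proof -
  have E: "((\<lambda>n. exp (- (p * n))) has_real_derivative - p * exp (- (p * n))) (at n)"
    by (auto intro!: derivative_eq_intros)
  have alg1: "(- p * E * n - E * 1) / (n * n) = - E * (p / n + 1 / n ^ 2)" for E
    using n by (simp add: field_simps power2_eq_square)
  show "((\<lambda>n. exp (- (p * n)) / n) has_real_derivative - exp (- (p * n)) * (p / n + 1 / n ^ 2)) (at n)"
    using n by (intro DERIV_cong[OF DERIV_divide[OF E DERIV_ident]] alg1) auto
  have r: "((\<lambda>n. p / n + 1 / n ^ 2) has_real_derivative - p / n ^ 2 - 2 / n ^ 3) (at n)"
  proof -
    have "((\<lambda>n. p * inverse n + (inverse n)\<^sup>2) has_real_derivative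
        p * - (inverse n)\<^sup>2 + 2 * (- (inverse n)\<^sup>2) * inverse n) (at n)"
      using n by (auto intro!: derivative_eq_intros simp: power2_eq_square)
    then show ?thesis
      unfolding divide_inverse power_inverse[symmetric] mult_1
      by (rule DERIV_cong) (simp add: power2_eq_square power3_eq_cube)
  qed
  have alg2: "- (- p * E) * (p / n + 1 / n ^ 2) + (- p / n ^ 2 - 2 / n ^ 3) * - E
      = E * (p\<^sup>2 / n + 2 * p / n ^ 2 + 2 / n ^ 3)" for E
    unfolding divide_inverse power_inverse[symmetric] by algebra
  show "((\<lambda>n. - exp (- (p * n)) * (p / n + 1 / n ^ 2)) has_real_derivative
       exp (- (p * n)) * (p\<^sup>2 / n + 2 * p / n ^ 2 + 2 / n ^ 3)) (at n)"
    by (intro DERIV_cong[OF DERIV_mult[OF DERIV_minus[OF E] r]] alg2)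
qed

lemma yukawa_line_derivatives:
  fixes z e :: "'a::euclidean_space" and p :: real
  assumes e: "norm e = 1" and nz: "z + s *\<^sub>R e \<noteq> 0"
  defines "y \<equiv> \<lambda>s. z + s *\<^sub>R e"
  defines "d1 \<equiv> \<lambda>s. - exp (- (p * norm (y s))) * (p / norm (y s) + 1 / norm (y s) ^ 2) * ((y s \<bullet> e) / norm (y s))"
  shows "((\<lambda>s. yukawa p (y s)) has_real_derivative d1 s) (at s)"
    and "(d1 has_real_derivative yukawa_d2 p e (y s)) (at s)"
proof -
  have ee: "e \<bullet> e = 1" using e by (simp add: norm_eq_sqrt_inner)
  have n: "norm (y s) > 0" using nz by (simp add: y_def)
  have dn: "((\<lambda>s. norm (y s)) has_real_derivative (y s \<bullet> e) / norm (y s)) (at s)"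
    unfolding y_def by (rule norm_line_has_real_derivative[OF e nz])
  have dc: "((\<lambda>s. y s \<bullet> e) has_real_derivative 1) (at s)"
    unfolding y_def inner_add_left inner_scaleR_left ee by (auto intro!: derivative_eq_intros)
  show "((\<lambda>s. yukawa p (y s)) has_real_derivative d1 s) (at s)"
    unfolding yukawa_def d1_def by (rule DERIV_chain2[OF yukawa_profile_derivatives(1)[OF n] dn])
  have alg: "E * (p\<^sup>2 / n + 2 * p / n ^ 2 + 2 / n ^ 3) * (c / n) * (c / n)
      + (1 * n - c * (c / n)) / (n * n) * (- E * (p / n + 1 / n ^ 2))
    = E * ((p\<^sup>2 / n + 2 * p / n ^ 2 + 2 / n ^ 3) * (c / n)\<^sup>2 - (p / n ^ 2 + 1 / n ^ 3) * (1 - (c / n)\<^sup>2))"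
    if "n > 0" for E n c :: real
  proof -
    define i where "i = inverse n"
    have "(1 * n - c * (c / n)) / (n * n) = i - c\<^sup>2 * i ^ 3"
      using that by (simp add: i_def divide_inverse power2_eq_square power3_eq_cube left_diff_distrib)
    moreover have "E * (p\<^sup>2 * i + 2 * p * i\<^sup>2 + 2 * i ^ 3) * (c * i) * (c * i) + (i - c\<^sup>2 * i ^ 3) * (- E * (p * i + 1 * i\<^sup>2))
      = E * ((p\<^sup>2 * i + 2 * p * i\<^sup>2 + 2 * i ^ 3) * (c * i)\<^sup>2 - (p * i\<^sup>2 + 1 * i ^ 3) * (1 - (c * i)\<^sup>2))"
      by (simp add: power2_eq_square power3_eq_cube algebra_simps)
    ultimately show ?thesis
      by (simp only: divide_inverse power_inverse[symmetric] i_def[symmetric])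
  qed
  define K2 where "K2 = exp (- (p * norm (y s))) * (p\<^sup>2 / norm (y s) + 2 * p / norm (y s) ^ 2 + 2 / norm (y s) ^ 3)"
  have profile: "((\<lambda>s. - exp (- (p * norm (y s))) * (p / norm (y s) + 1 / norm (y s) ^ 2))
      has_real_derivative K2 * ((y s \<bullet> e) / norm (y s))) (at s)"
    unfolding K2_def by (rule DERIV_chain2[OF yukawa_profile_derivatives(2)[OF n] dn])
  have cosine: "((\<lambda>s. (y s \<bullet> e) / norm (y s)) has_real_derivative
      (1 * norm (y s) - (y s \<bullet> e) * ((y s \<bullet> e) / norm (y s))) / (norm (y s) * norm (y s))) (at s)"
    using n by (intro DERIV_divide[OF dc dn]) simp
  show "(d1 has_real_derivative yukawa_d2 p e (y s)) (at s)"
    unfolding d1_def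
    by (rule DERIV_cong[OF DERIV_mult[OF profile cosine]]) (unfold K2_def yukawa_d2_def, rule alg[OF n])
qed

lemma abs_yukawa_d2_le:
  assumes p: "p \<ge> 0" and d: "0 < d" "d \<le> norm z" and e: "norm e = 1"
  shows "\<bar>yukawa_d2 p e z\<bar> \<le> p\<^sup>2 / d + 3 * p / d ^ 2 + 3 / d ^ 3"
proof -
  define n where "n = norm z"
  define q where "q = ((z \<bullet> e) / n)\<^sup>2"
  have n: "n > 0" "d \<le> n" using d by (auto simp: n_def)
  have "\<bar>z \<bullet> e\<bar> \<le> n" using Cauchy_Schwarz_ineq2[of z e] e by (simp add: n_def)
  then have q: "0 \<le> q" "q \<le> 1" using n by (auto simp: q_def power_divide abs_le_square_iff[symmetric])
  have abs_diff_le: "\<bar>u - v\<bar> \<le> a + b" if "0 \<le> u" "u \<le> a" "0 \<le> v" "v \<le> b" for a b u v :: real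
    using that by linarith
  define a where "a = p\<^sup>2 / n + 2 * p / n ^ 2 + 2 / n ^ 3"
  define b where "b = p / n ^ 2 + 1 / n ^ 3"
  have ab: "0 \<le> a" "0 \<le> b" using p n by (auto simp: a_def b_def)
  have aq: "0 \<le> a * q" "a * q \<le> a" "0 \<le> b * (1 - q)" "b * (1 - q) \<le> b"
    using ab q by (auto simp: mult_left_le)
  have "\<bar>yukawa_d2 p e z\<bar> = exp (- (p * n)) * \<bar>a * q - b * (1 - q)\<bar>"
    by (simp add: yukawa_d2_def a_def b_def q_def n_def abs_mult)
  also have "\<dots> \<le> 1 * \<bar>a * q - b * (1 - q)\<bar>"
    using p n by (intro mult_right_mono) auto
  also have "\<dots> \<le> a + b" using abs_diff_le[OF aq] by simp
  also have "\<dots> = p\<^sup>2 / n + 3 * p / n ^ 2 + 3 / n ^ 3" by (simp add: a_def b_def add_divide_distrib[symmetric])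
  also have "\<dots> \<le> p\<^sup>2 / d + 3 * p / d ^ 2 + 3 / d ^ 3"
    using p n d by (intro add_mono divide_left_mono power_mono mult_pos_pos) auto
  finally show ?thesis .
qed

text \<open>The equation \<open>\<Delta>k = p\<^sup>2 k\<close>: the squared cosines with the three coordinate axes add up to \<open>1\<close>, the
  squared sines to \<open>2\<close>.\<close>

lemma sum_yukawa_d2:
  fixes z :: "'a::euclidean_space"
  assumes dim: "DIM('a) = 3" and z: "z \<noteq> 0"
  shows "(\<Sum>e\<in>Basis. yukawa_d2 p e z) = p\<^sup>2 * yukawa p z"
proof -
  define n where "n = norm z"
  have n: "n > 0" using z by (simp add: n_def)
  have "(\<Sum>e\<in>Basis. (z \<bullet> e)\<^sup>2) = n\<^sup>2"
    unfolding n_def power2_norm_eq_inner euclidean_inner[of z z] by (simp add: power2_eq_square)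
  then have q: "(\<Sum>e\<in>Basis. ((z \<bullet> e) / n)\<^sup>2) = 1"
    using n by (simp add: power_divide sum_divide_distrib[symmetric])
  have "(\<Sum>e\<in>Basis. yukawa_d2 p e z) = exp (- (p * n)) *
     ((p\<^sup>2 / n + 2 * p / n ^ 2 + 2 / n ^ 3) * (\<Sum>e\<in>Basis. ((z \<bullet> e) / n)\<^sup>2)
      - (p / n ^ 2 + 1 / n ^ 3) * (\<Sum>e\<in>Basis. 1 - ((z \<bullet> e) / n)\<^sup>2))"
    by (simp add: yukawa_d2_def n_def sum_distrib_left sum_subtractf right_diff_distrib)
  also have "\<dots> = exp (- (p * n)) * ((p\<^sup>2 / n + 2 * p / n ^ 2 + 2 / n ^ 3) - (p / n ^ 2 + 1 / n ^ 3) * 2)"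
    by (simp add: q sum_subtractf dim)
  also have "\<dots> = p\<^sup>2 * yukawa p z"
    unfolding yukawa_def n_def[symmetric] using n by (simp add: field_simps power2_eq_square power3_eq_cube)
  finally show ?thesis .
qed

text \<open>Taylor's formula of order two for the even function \<open>s \<mapsto> k(z + s e) + k(z - s e)\<close>, whose first
  derivative vanishes at \<open>0\<close>.\<close>

lemma second_difference_yukawa:
  fixes z e :: "'a::euclidean_space"
  assumes e: "norm e = 1" and t: "0 < t" "t < norm z"
  obtains s where "0 < s" "s \<le> t"
    "second_difference (yukawa p) e t z = (yukawa_d2 p e (z + s *\<^sub>R e) + yukawa_d2 p e (z - s *\<^sub>R e)) / 2"
proof -
  define d1 where "d1 s = - exp (- (p * norm (z + s *\<^sub>R e))) * (p / norm (z + s *\<^sub>R e) + 1 / norm (z + s *\<^sub>R e) ^ 2) * (((z + s *\<^sub>R e) \<bullet> e) / norm (z + s *\<^sub>R e))" for s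
  have nz: "z + s *\<^sub>R e \<noteq> 0" if "\<bar>s\<bar> \<le> t" for s
  proof
    assume "z + s *\<^sub>R e = 0"
    then have "z = - (s *\<^sub>R e)" by (simp add: eq_neg_iff_add_eq_0)
    then have "norm z = \<bar>s\<bar>" using e by simp
    then show False using that t by simp
  qed
  have D0: "((\<lambda>s. yukawa p (z + s *\<^sub>R e)) has_real_derivative d1 s) (at s)"
    and D1: "(d1 has_real_derivative yukawa_d2 p e (z + s *\<^sub>R e)) (at s)" if "\<bar>s\<bar> \<le> t" for s
    using yukawa_line_derivatives[OF e nz[OF that], of p] unfolding d1_def by auto
  define diff where "diff m = (\<lambda>s. if m = 0 then yukawa p (z + s *\<^sub>R e) + yukawa p (z + (- s) *\<^sub>R e)
     else if m = 1 then d1 s - d1 (- s)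
     else yukawa_d2 p e (z + s *\<^sub>R e) + yukawa_d2 p e (z + (- s) *\<^sub>R e))" for m :: nat
  have "\<forall>m s. m < 2 \<and> 0 \<le> s \<and> s \<le> t \<longrightarrow> DERIV (diff m) s :> diff (Suc m) s"
  proof (intro allI impI)
    fix m s assume a: "m < (2::nat) \<and> 0 \<le> s \<and> s \<le> t"
    then have s: "\<bar>s\<bar> \<le> t" "\<bar>-s\<bar> \<le> t" by auto
    have m0: "((\<lambda>s. yukawa p (z + (- s) *\<^sub>R e)) has_real_derivative d1 (- s) * - 1) (at s)"
      by (rule DERIV_chain2[where f = "\<lambda>s. yukawa p (z + s *\<^sub>R e)" and g = uminus, OF D0[OF s(2)]])
        (auto intro!: derivative_eq_intros)
    have m1: "((\<lambda>s. d1 (- s)) has_real_derivative yukawa_d2 p e (z + (- s) *\<^sub>R e) * - 1) (at s)"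
      by (rule DERIV_chain2[where f = d1 and g = uminus, OF D1[OF s(2)]])
        (auto intro!: derivative_eq_intros)
    consider "m = 0" | "m = 1" using a by linarith
    then show "DERIV (diff m) s :> diff (Suc m) s"
    proof cases
      case 1
      then show ?thesis using DERIV_add[OF D0[OF s(1)] m0] by (simp add: diff_def)
    next
      case 2
      then show ?thesis using DERIV_diff[OF D1[OF s(1)] m1] by (simp add: diff_def)
    qed
  qed
  from Maclaurin2[OF t(1) refl this] obtain s where s: "0 < s" "s \<le> t"
    "diff 0 t = (\<Sum>m<2. diff m 0 / fact m * t ^ m) + diff 2 s / fact 2 * t\<^sup>2"
    by auto
  have "second_difference (yukawa p) e t z = (yukawa_d2 p e (z + s *\<^sub>R e) + yukawa_d2 p e (z - s *\<^sub>R e)) / 2"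
    using s(3) t(1) by (simp add: diff_def second_difference_def numeral_2_eq_2 field_simps)
  then show thesis using s that by blast
qed

lemma second_difference_yukawa_bound:
  assumes e: "norm e = 1" and t: "0 < t" "t \<le> d / 2" and d: "d \<le> norm z" and p: "p \<ge> 0"
  shows "\<bar>second_difference (yukawa p) e t z\<bar> \<le> p\<^sup>2 / (d/2) + 3 * p / (d/2) ^ 2 + 3 / (d/2) ^ 3"
proof -
  have "t < norm z" using t d by linarith
  from second_difference_yukawa[OF e t(1) this] obtain s where s: "0 < s" "s \<le> t"
    "second_difference (yukawa p) e t z = (yukawa_d2 p e (z + s *\<^sub>R e) + yukawa_d2 p e (z - s *\<^sub>R e)) / 2"
    by metis
  have "norm z - s \<le> norm (z + s *\<^sub>R e)" "norm z - s \<le> norm (z - s *\<^sub>R e)"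
    using norm_diff_ineq[of z "s *\<^sub>R e"] norm_triangle_ineq2[of z "s *\<^sub>R e"] e s by auto
  then have "d / 2 \<le> norm (z + s *\<^sub>R e)" "d / 2 \<le> norm (z - s *\<^sub>R e)" using s t d by auto
  then have "\<bar>yukawa_d2 p e (z + s *\<^sub>R e)\<bar> \<le> p\<^sup>2 / (d/2) + 3 * p / (d/2) ^ 2 + 3 / (d/2) ^ 3"
    "\<bar>yukawa_d2 p e (z - s *\<^sub>R e)\<bar> \<le> p\<^sup>2 / (d/2) + 3 * p / (d/2) ^ 2 + 3 / (d/2) ^ 3"
    using abs_yukawa_d2_le[OF p _ _ e, of "d/2"] t by auto
  moreover have "\<bar>(u + v) / 2\<bar> \<le> K" if "\<bar>u\<bar> \<le> K" "\<bar>v\<bar> \<le> K" for u v K :: real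
    using that by (simp add: abs_le_iff)
  ultimately show ?thesis unfolding s(3) by blast
qed

lemma second_difference_yukawa_tendsto:
  fixes z e :: "'a::euclidean_space"
  assumes e: "norm e = 1" and z: "z \<noteq> 0" and t: "\<And>n. t n > 0" "t \<longlonglongrightarrow> 0"
  shows "(\<lambda>n. second_difference (yukawa p) e (t n) z) \<longlonglongrightarrow> yukawa_d2 p e z"
proof -
  have "\<exists>s. t n < norm z \<longrightarrow> 0 < s \<and> s \<le> t n \<and>
    second_difference (yukawa p) e (t n) z = (yukawa_d2 p e (z + s *\<^sub>R e) + yukawa_d2 p e (z - s *\<^sub>R e)) / 2" for n
    using second_difference_yukawa[OF e t(1)[of n], of z p] by metis
  then obtain s where s: "\<And>n. t n < norm z \<Longrightarrow> 0 < s n \<and> s n \<le> t n \<and>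
    second_difference (yukawa p) e (t n) z = (yukawa_d2 p e (z + s n *\<^sub>R e) + yukawa_d2 p e (z - s n *\<^sub>R e)) / 2"
    by metis
  have ev: "\<forall>\<^sub>F n in sequentially. t n < norm z" using t(2) z by (intro order_tendstoD) auto
  have s0: "s \<longlonglongrightarrow> 0"
    by (rule Lim_null_comparison[OF _ t(2)]) (use ev in eventually_elim, use s in force)
  have c: "isCont (yukawa_d2 p e) z"
    unfolding yukawa_d2_def using z by (intro continuous_intros) auto
  have "(\<lambda>n. yukawa_d2 p e (z + s n *\<^sub>R e)) \<longlonglongrightarrow> yukawa_d2 p e z"
    "(\<lambda>n. yukawa_d2 p e (z - s n *\<^sub>R e)) \<longlonglongrightarrow> yukawa_d2 p e z"
    by (rule isCont_tendsto_compose[OF c], use s0 in \<open>auto intro!: tendsto_eq_intros\<close>)+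
  then have "(\<lambda>n. (yukawa_d2 p e (z + s n *\<^sub>R e) + yukawa_d2 p e (z - s n *\<^sub>R e)) / 2) \<longlonglongrightarrow> yukawa_d2 p e z"
    by (auto intro!: tendsto_eq_intros)
  then show ?thesis
    by (rule Lim_transform_eventually) (use ev in eventually_elim, use s in force)
qed

text \<open>If \<open>D\<close> were positive somewhere, then, being nonpositive on the sphere and small at infinity, it would
  attain a positive maximum at some point strictly outside the sphere. All second differences are
  nonpositive there, in contradiction to \<open>\<Delta>D = p\<^sup>2 D > 0\<close>.\<close>

lemma exterior_maximum_principle:
  fixes D :: "'a::euclidean_space \<Rightarrow> real"
  assumes cont: "continuous_on {x. R \<le> norm x} D"
    and sphere: "\<And>x. norm x = R \<Longrightarrow> D x \<le> 0"
    and inf: "(D \<longlongrightarrow> 0) at_infinity"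
    and lap: "\<And>x. R < norm x \<Longrightarrow> (\<lambda>n. discrete_laplacian D (inverse (real (Suc n))) x) \<longlonglongrightarrow> p\<^sup>2 * D x"
    and p: "p \<noteq> 0" and x: "R \<le> norm x"
  shows "D x \<le> 0"
proof (rule ccontr)
  assume "\<not> D x \<le> 0"
  then have Dx: "D x > 0" by simp
  then have "\<forall>\<^sub>F y in at_infinity. D y < D x" using inf by (intro order_tendstoD) auto
  then obtain N where N: "\<And>y. N \<le> norm y \<Longrightarrow> D y < D x" by (auto simp: eventually_at_infinity)
  define S :: "'a set" where "S = cball 0 N \<inter> {y. R \<le> norm y}"
  have "closed {y::'a. R \<le> norm y}" by (intro closed_Collect_le continuous_intros)
  then have S: "compact S" unfolding S_def by (rule compact_Int_closed[OF compact_cball])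
  have xS: "x \<in> S" using N[of x] x by (force simp: S_def)
  have "continuous_on S D" using cont by (rule continuous_on_subset) (auto simp: S_def)
  from continuous_attains_sup[OF S _ this] xS
  obtain x0 where x0: "x0 \<in> S" "\<And>y. y \<in> S \<Longrightarrow> D y \<le> D x0" by blast
  have Dx0: "D x \<le> D x0" using x0(2)[OF xS] .
  have max: "D y \<le> D x0" if "R \<le> norm y" for y
  proof (cases "norm y \<le> N")
    case True then show ?thesis using that by (intro x0) (simp add: S_def)
  next
    case False then show ?thesis using N[of y] Dx0 by simp
  qed
  have R: "R < norm x0" using x0(1) sphere[of x0] Dx Dx0 by (cases "norm x0 = R") (auto simp: S_def)
  have "\<forall>\<^sub>F n in sequentially. inverse (real (Suc n)) < norm x0 - R"
    using R LIMSEQ_inverse_real_of_nat by (intro order_tendstoD) auto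
  then have "\<forall>\<^sub>F n in sequentially. discrete_laplacian D (inverse (real (Suc n))) x0 \<le> 0"
  proof eventually_elim
    case (elim n)
    define t where "t = inverse (real (Suc n))"
    have t: "0 < t" "t < norm x0 - R" using elim by (auto simp: t_def)
    have "second_difference D e t x0 \<le> 0" if "e \<in> Basis" for e
    proof -
      have "norm x0 - t \<le> norm (x0 + t *\<^sub>R e)" "norm x0 - t \<le> norm (x0 - t *\<^sub>R e)"
        using norm_diff_ineq[of x0 "t *\<^sub>R e"] norm_triangle_ineq2[of x0 "t *\<^sub>R e"] that t by auto
      then have "D (x0 + t *\<^sub>R e) \<le> D x0" "D (x0 - t *\<^sub>R e) \<le> D x0" using t by (auto intro!: max)
      then show ?thesis by (auto simp: second_difference_def intro!: divide_nonpos_nonneg)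
    qed
    then show ?case unfolding discrete_laplacian_def t_def by (rule sum_nonpos)
  qed
  from tendsto_upperbound[OF lap[OF R] this] have "p\<^sup>2 * D x0 \<le> 0" by simp
  moreover have "p\<^sup>2 * D x0 > 0" using p Dx Dx0 by simp
  ultimately show False by simp
qed

section \<open>The far field of a superposition of Yukawa kernels\<close>

lemma abs_yukawa_le:
  assumes "p \<ge> 0" "0 < d" "d \<le> norm z" shows "\<bar>yukawa p z\<bar> \<le> 1 / d"
proof -
  have "exp (- (p * norm z)) / norm z \<le> 1 / d" using assms by (intro frac_le) auto
  then show ?thesis by (simp add: yukawa_def)
qed

lemma tendsto_integral_mult_bounded:
  fixes g :: "'b \<Rightarrow> real" and k :: "nat \<Rightarrow> 'b \<Rightarrow> real"
  assumes g: "integrable M g" and [measurable]: "\<And>n. k n \<in> borel_measurable M" "k' \<in> borel_measurable M"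
    and lim: "\<And>w. w \<in> space M \<Longrightarrow> g w \<noteq> 0 \<Longrightarrow> (\<lambda>n. k n w) \<longlonglongrightarrow> k' w"
    and bound: "\<And>n w. w \<in> space M \<Longrightarrow> g w \<noteq> 0 \<Longrightarrow> \<bar>k n w\<bar> \<le> K"
  shows "(\<lambda>n. \<integral>w. g w * k n w \<partial>M) \<longlonglongrightarrow> (\<integral>w. g w * k' w \<partial>M)"
proof (rule integral_dominated_convergence[where w = "\<lambda>w. \<bar>g w\<bar> * K"])
  show "AE w in M. (\<lambda>n. g w * k n w) \<longlonglongrightarrow> g w * k' w"
  proof (rule AE_I2)
    fix w assume "w \<in> space M"
    then show "(\<lambda>n. g w * k n w) \<longlonglongrightarrow> g w * k' w"
      using lim[of w] by (cases "g w = 0") (auto intro!: tendsto_intros)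
  qed
  show "AE w in M. norm (g w * k n w) \<le> \<bar>g w\<bar> * K" for n
  proof (rule AE_I2)
    fix w assume "w \<in> space M"
    then show "norm (g w * k n w) \<le> \<bar>g w\<bar> * K"
      using bound[of w n] by (cases "g w = 0") (auto simp: abs_mult intro!: mult_left_mono)
  qed
qed (use g in auto)

lemma integrable_mult_bounded:
  fixes g k :: "'b \<Rightarrow> real"
  assumes g: "integrable M g" and [measurable]: "k \<in> borel_measurable M"
    and bound: "\<And>w. w \<in> space M \<Longrightarrow> g w \<noteq> 0 \<Longrightarrow> \<bar>k w\<bar> \<le> K"
  shows "integrable M (\<lambda>w. g w * k w)"
proof (rule Bochner_Integration.integrable_bound[where f = "\<lambda>w. g w * K"])
  have "\<bar>g w * k w\<bar> \<le> \<bar>g w * K\<bar>" if "w \<in> space M" for w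
    using bound[OF that] by (cases "g w = 0") (auto simp: abs_mult intro!: mult_left_mono)
  then show "AE w in M. norm (g w * k w) \<le> norm (g w * K)" by simp
qed (use g in auto)

text \<open>A superposition of Yukawa kernels with centres \<open>y(w)\<close> and weights \<open>g(w)\<close>, indexed by an arbitrary measure
  space. In the application \<open>w = (y,s)\<close> and the weight contains the factor \<open>exp(-ps)\<close> of the Laplace transform; a
  one-point index space gives the barrier.\<close>

locale yukawa_potential =
  fixes M :: "'b measure" and g :: "'b \<Rightarrow> real" and y :: "'b \<Rightarrow> 'a::euclidean_space" and p \<rho> :: real
  assumes g: "integrable M g" and y[measurable]: "y \<in> borel_measurable M"
    and supp: "\<And>w. w \<in> space M \<Longrightarrow> g w \<noteq> 0 \<Longrightarrow> norm (y w) \<le> \<rho>"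
    and p: "p > 0" and dim: "DIM('a) = 3" and \<rho>: "\<rho> \<ge> 0"
begin

definition potential :: "'a \<Rightarrow> real" where "potential x = (\<integral>w. g w * yukawa p (x - y w) \<partial>M)"

lemma measurable_yukawa [measurable]: "yukawa p \<in> borel_measurable (borel :: 'a measure)"
  unfolding yukawa_def by measurable

lemma dist_supp: "w \<in> space M \<Longrightarrow> g w \<noteq> 0 \<Longrightarrow> norm x - \<rho> \<le> norm (x - y w)"
  using supp[of w] norm_triangle_ineq2[of x "y w"] by linarith

lemma integrable_potential:
  assumes "norm x > \<rho>" shows "integrable M (\<lambda>w. g w * yukawa p (x - y w))"
  by (rule integrable_mult_bounded[OF g, where K = "1 / (norm x - \<rho>)"])
    (use p assms dist_supp in \<open>auto intro!: abs_yukawa_le\<close>)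

lemma isCont_potential:
  assumes x: "norm x > \<rho>" shows "isCont potential x"
  unfolding continuous_at_sequentially
proof safe
  fix X :: "nat \<Rightarrow> 'a" assume X: "X \<longlonglongrightarrow> x"
  define d where "d = (norm x - \<rho>) / 2"
  have d: "d > 0" using x by (simp add: d_def)
  have "\<forall>\<^sub>F n in sequentially. norm (X n) > \<rho> + d"
    using X x by (intro order_tendstoD(1)[OF tendsto_norm[OF X]]) (simp add: d_def field_simps)
  then obtain N where N: "\<And>n. n \<ge> N \<Longrightarrow> norm (X n) > \<rho> + d" by (auto simp: eventually_sequentially)
  have "(\<lambda>n. potential (X (n + N))) \<longlonglongrightarrow> potential x" unfolding potential_def
  proof (rule tendsto_integral_mult_bounded[OF g])
    fix w assume w: "w \<in> space M" "g w \<noteq> 0"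
    have "norm (x - y w) > 0" using dist_supp[OF w, of x] x by linarith
    then show "(\<lambda>n. yukawa p (X (n + N) - y w)) \<longlonglongrightarrow> yukawa p (x - y w)"
      unfolding yukawa_def using LIMSEQ_ignore_initial_segment[OF X, of N] by (intro tendsto_intros) auto
    show "\<bar>yukawa p (X (n + N) - y w)\<bar> \<le> 1 / d" for n
      using p d dist_supp[OF w, of "X (n + N)"] N[of "n + N"] by (intro abs_yukawa_le) auto
  qed measurable
  then show "(potential \<circ> X) \<longlonglongrightarrow> potential x" unfolding comp_def by (rule LIMSEQ_offset)
qed

lemma potential_tendsto_0: "(potential \<longlongrightarrow> 0) at_infinity"
proof (rule Lim_null_comparison)
  have "\<forall>\<^sub>F x in at_infinity. norm (x::'a) \<ge> \<rho> + 1" by (auto simp: eventually_at_infinity)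
  then show "\<forall>\<^sub>F x in at_infinity. norm (potential x) \<le> (\<integral>w. \<bar>g w\<bar> \<partial>M) * (1 / (norm x - \<rho>))"
  proof eventually_elim
    case (elim x)
    have "norm (potential x) \<le> (\<integral>w. \<bar>g w\<bar> * (1 / (norm x - \<rho>)) \<partial>M)"
      unfolding potential_def
    proof (rule order_trans[OF integral_norm_bound integral_mono])
      show "integrable M (\<lambda>w. norm (g w * yukawa p (x - y w)))" using integrable_potential[of x] elim by simp
      show "integrable M (\<lambda>w. \<bar>g w\<bar> * (1 / (norm x - \<rho>)))" using g by simp
      fix w assume w: "w \<in> space M"
      show "norm (g w * yukawa p (x - y w)) \<le> \<bar>g w\<bar> * (1 / (norm x - \<rho>))"
      proof (cases "g w = 0")
        case False
        have "\<bar>yukawa p (x - y w)\<bar> \<le> 1 / (norm x - \<rho>)"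
          using p elim dist_supp[OF w False, of x] by (intro abs_yukawa_le) auto
        then show ?thesis unfolding real_norm_def abs_mult by (intro mult_left_mono) auto
      qed simp
    qed
    then show ?case by simp
  qed
  have "((\<lambda>r. 1 / (r - \<rho>)) \<longlongrightarrow> 0) at_top" by real_asymp
  then have "((\<lambda>r. (\<integral>w. \<bar>g w\<bar> \<partial>M) * (1 / (r - \<rho>))) \<longlongrightarrow> 0) at_top"
    by (rule tendsto_mult_right_zero)
  from filterlim_compose[OF this filterlim_norm_at_top]
  show "((\<lambda>x::'a. (\<integral>w. \<bar>g w\<bar> \<partial>M) * (1 / (norm x - \<rho>))) \<longlongrightarrow> 0) at_infinity" .
qed

lemma discrete_laplacian_potential:
  assumes x: "norm x > \<rho>"
  shows "(\<lambda>n. discrete_laplacian potential (inverse (real (Suc n))) x) \<longlonglongrightarrow> p\<^sup>2 * potential x"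
proof -
  define d where "d = norm x - \<rho>"
  have d: "d > 0" using x by (simp add: d_def)
  obtain N where "inverse (real (Suc N)) < d / 2" using reals_Archimedean[of "d/2"] d by auto
  then have N: "inverse (real (Suc n)) \<le> d / 2" if "n \<ge> N" for n
    using that by (meson le_imp_inverse_le less_imp_le of_nat_0_less_iff of_nat_le_iff order_trans Suc_le_mono zero_less_Suc)
  define t where "t n = inverse (real (Suc (n + N)))" for n
  have t: "t n > 0" "t n \<le> d / 2" for n using N[of "n + N"] by (auto simp: t_def)
  have tlim: "t \<longlonglongrightarrow> 0"
    unfolding t_def using LIMSEQ_ignore_initial_segment[OF LIMSEQ_inverse_real_of_nat, of N] by simp
  have sd: "second_difference potential e (t n) x = (\<integral>w. g w * second_difference (yukawa p) e (t n) (x - y w) \<partial>M)"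
    if "e \<in> Basis" for e n
  proof -
    have "norm x - t n \<le> norm (x + t n *\<^sub>R e)" "norm x - t n \<le> norm (x - t n *\<^sub>R e)"
      using norm_diff_ineq[of x "t n *\<^sub>R e"] norm_triangle_ineq2[of x "t n *\<^sub>R e"] that t(1)[of n] by auto
    then have n: "\<rho> < norm (x + t n *\<^sub>R e)" "\<rho> < norm (x - t n *\<^sub>R e)" using t[of n] d by (auto simp: d_def)
    note i = integrable_potential[OF n(1)] integrable_potential[OF n(2)] integrable_potential[OF x]
    have "second_difference potential e (t n) x = (\<integral>w. (g w * yukawa p (x + t n *\<^sub>R e - y w) + g w * yukawa p (x - t n *\<^sub>R e - y w)
        - 2 * (g w * yukawa p (x - y w))) / (t n)\<^sup>2 \<partial>M)"
      unfolding second_difference_def potential_def using i by simp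
    also have "\<dots> = (\<integral>w. g w * second_difference (yukawa p) e (t n) (x - y w) \<partial>M)"
    proof (rule Bochner_Integration.integral_cong[OF refl])
      fix w
      have "x + t n *\<^sub>R e - y w = x - y w + t n *\<^sub>R e" "x - t n *\<^sub>R e - y w = x - y w - t n *\<^sub>R e" by auto
      then show "(g w * yukawa p (x + t n *\<^sub>R e - y w) + g w * yukawa p (x - t n *\<^sub>R e - y w)
        - 2 * (g w * yukawa p (x - y w))) / (t n)\<^sup>2 = g w * second_difference (yukawa p) e (t n) (x - y w)"
        unfolding second_difference_def by (simp add: field_simps)
    qed
    finally show ?thesis .
  qed
  define K where "K = p\<^sup>2 / (d/2) + 3 * p / (d/2) ^ 2 + 3 / (d/2) ^ 3"
  have b: "\<bar>second_difference (yukawa p) e (t n) (x - y w)\<bar> \<le> K" if "w \<in> space M" "g w \<noteq> 0" "e \<in> Basis" for w e n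
    unfolding K_def using that p t[of n] dist_supp[OF that(1,2), of x]
    by (intro second_difference_yukawa_bound) (auto simp: d_def)
  have [measurable]: "(\<lambda>w. second_difference (yukawa p) e (t n) (x - y w)) \<in> borel_measurable M" for e n
    unfolding second_difference_def by measurable
  have "(\<lambda>n. discrete_laplacian potential (t n) x) \<longlonglongrightarrow> (\<Sum>e\<in>Basis. \<integral>w. g w * yukawa_d2 p e (x - y w) \<partial>M)"
    unfolding discrete_laplacian_def
  proof (rule tendsto_sum)
    fix e :: 'a assume e: "e \<in> Basis"
    show "(\<lambda>n. second_difference potential e (t n) x) \<longlonglongrightarrow> (\<integral>w. g w * yukawa_d2 p e (x - y w) \<partial>M)"
      unfolding sd[OF e]
    proof (rule tendsto_integral_mult_bounded[OF g])
      fix w assume w: "w \<in> space M" "g w \<noteq> 0"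
      have "x - y w \<noteq> 0" using dist_supp[OF w, of x] x by auto
      then show "(\<lambda>n. second_difference (yukawa p) e (t n) (x - y w)) \<longlonglongrightarrow> yukawa_d2 p e (x - y w)"
        using e t(1) tlim by (intro second_difference_yukawa_tendsto) auto
      show "\<bar>second_difference (yukawa p) e (t n) (x - y w)\<bar> \<le> K" for n by (rule b[OF w e])
    qed (measurable, simp add: yukawa_d2_def)
  qed
  also have "(\<Sum>e\<in>Basis. \<integral>w. g w * yukawa_d2 p e (x - y w) \<partial>M) = (\<integral>w. (\<Sum>e\<in>Basis. g w * yukawa_d2 p e (x - y w)) \<partial>M)"
  proof (rule Bochner_Integration.integral_sum[symmetric])
    fix e :: 'a assume e: "e \<in> Basis"
    show "integrable M (\<lambda>w. g w * yukawa_d2 p e (x - y w))"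
    proof (rule integrable_mult_bounded[OF g, where K = "p\<^sup>2 / d + 3 * p / d ^ 2 + 3 / d ^ 3"])
      show "\<bar>yukawa_d2 p e (x - y w)\<bar> \<le> p\<^sup>2 / d + 3 * p / d ^ 2 + 3 / d ^ 3" if "w \<in> space M" "g w \<noteq> 0" for w
        using p d e dist_supp[OF that, of x] by (intro abs_yukawa_d2_le) (auto simp: d_def)
    qed (simp add: yukawa_d2_def)
  qed
  also have "\<dots> = (\<integral>w. p\<^sup>2 * (g w * yukawa p (x - y w)) \<partial>M)"
  proof (rule Bochner_Integration.integral_cong[OF refl])
    fix w assume w: "w \<in> space M"
    show "(\<Sum>e\<in>Basis. g w * yukawa_d2 p e (x - y w)) = p\<^sup>2 * (g w * yukawa p (x - y w))"
    proof (cases "g w = 0")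
      case False
      then have "x - y w \<noteq> 0" using dist_supp[OF w False, of x] x by auto
      from sum_yukawa_d2[OF dim this, of p] show ?thesis by (simp add: sum_distrib_left[symmetric])
    qed simp
  qed
  also have "\<dots> = p\<^sup>2 * potential x" by (simp add: potential_def)
  finally show ?thesis unfolding t_def by (rule LIMSEQ_offset[where k = N])
qed

end

context yukawa_potential
begin

text \<open>The barrier is the multiple of the Yukawa kernel at the origin that equals \<open>C\<close> on the sphere.\<close>

lemma potential_le_barrier:
  assumes R: "R > \<rho>" and C: "\<And>x. norm x = R \<Longrightarrow> potential x \<le> C" and x: "norm x \<ge> R"
  shows "potential x \<le> C * R * exp (p * R) * yukawa p x"
proof -
  define c where "c = C * R * exp (p * R)"
  have R0: "R > 0" using R \<rho> by simp
  interpret pt: yukawa_potential "count_space (UNIV :: unit set)" "\<lambda>_. c" "\<lambda>_. 0 :: 'a" p 0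
    by unfold_locales (use p dim in \<open>auto simp: integrable_count_space\<close>)
  have pt: "pt.potential = (\<lambda>x. c * yukawa p x)"
    unfolding pt.potential_def by (simp add: lebesgue_integral_count_space_finite)
  have "potential x - pt.potential x \<le> 0"
  proof (rule exterior_maximum_principle[where D = "\<lambda>x. potential x - pt.potential x" and R = R and p = p])
    show "continuous_on {x. R \<le> norm x} (\<lambda>x. potential x - pt.potential x)"
      using R R0 by (intro continuous_at_imp_continuous_on continuous_intros ballI isCont_potential pt.isCont_potential) auto
    show "((\<lambda>x. potential x - pt.potential x) \<longlongrightarrow> 0) at_infinity"
      using tendsto_diff[OF potential_tendsto_0 pt.potential_tendsto_0] by simp
    fix z :: 'a
    show "potential z - pt.potential z \<le> 0" if z: "norm z = R"
    proof -
      have "pt.potential z = C"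
        unfolding pt unfolding c_def using z R0 by (simp add: yukawa_def exp_minus)
      then show ?thesis using C[OF z] by simp
    qed
    show "(\<lambda>n. discrete_laplacian (\<lambda>x. potential x - pt.potential x) (inverse (real (Suc n))) z) \<longlonglongrightarrow> p\<^sup>2 * (potential z - pt.potential z)"
      if z: "R < norm z"
    proof -
      have "discrete_laplacian (\<lambda>x. potential x - pt.potential x) t z = discrete_laplacian potential t z - discrete_laplacian pt.potential t z" for t
        unfolding discrete_laplacian_def sum_subtractf[symmetric] second_difference_def
        by (intro sum.cong refl) (simp add: diff_divide_distrib[symmetric])
      moreover have "norm z > \<rho>" "norm z > 0" using z R R0 by auto
      ultimately show ?thesis
        using tendsto_diff[OF discrete_laplacian_potential[of z] pt.discrete_laplacian_potential[of z]] by (simp add: right_diff_distrib)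
    qed
  qed (use p x in auto)
  then show ?thesis unfolding pt by (simp add: c_def)
qed

text \<open>As \<open>\<lambda> \<rightarrow> \<infinity>\<close>, \<open>\<lambda> exp(p\<lambda>)\<close> times the Yukawa kernel at \<open>\<lambda>\<theta> - y\<close> tends to \<open>exp(p \<theta>\<cdot>y)\<close>, because
  \<open>\<lambda> - |\<lambda>\<theta> - y| \<rightarrow> \<theta>\<cdot>y\<close>. The same factor turns the barrier into a constant.\<close>

lemma far_field_le:
  assumes R: "R > \<rho>" and C: "\<And>x. norm x = R \<Longrightarrow> potential x \<le> C" and \<theta>: "norm \<theta> = 1"
  shows "(\<integral>w. g w * exp (p * (\<theta> \<bullet> y w)) \<partial>M) \<le> C * R * exp (p * R)"
proof -
  obtain N :: nat where N: "real N > R + \<rho> + 1" using reals_Archimedean2 by blast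
  define l where "l n = real (n + N)" for n
  have l: "l n > R + \<rho> + 1" for n using N by (simp add: l_def)
  have nl: "norm (l n *\<^sub>R \<theta>) = l n" for n using \<theta> l[of n] R \<rho> by simp
  have \<theta>\<theta>: "\<theta> \<bullet> \<theta> = 1" using \<theta> by (simp add: norm_eq_sqrt_inner)
  \<comment> \<open>The distances \<open>l n\<close> start beyond \<open>R + \<rho> + 1\<close>, so that the kernels are uniformly bounded.\<close>
  let ?k = "\<lambda>n w. l n * exp (p * l n) * yukawa p (l n *\<^sub>R \<theta> - y w)"
  have lim: "(\<lambda>n. \<integral>w. g w * ?k n w \<partial>M) \<longlonglongrightarrow> (\<integral>w. g w * exp (p * (\<theta> \<bullet> y w)) \<partial>M)"
  proof (rule tendsto_integral_mult_bounded[OF g])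
    fix w assume w: "w \<in> space M" "g w \<noteq> 0"
    have d: "l n - \<rho> \<le> norm (l n *\<^sub>R \<theta> - y w)" "l n - norm (l n *\<^sub>R \<theta> - y w) \<le> \<rho>" for n
      using dist_supp[OF w, of "l n *\<^sub>R \<theta>"] nl by auto
    have k: "?k n w = (l n / norm (l n *\<^sub>R \<theta> - y w)) * exp (p * (l n - norm (l n *\<^sub>R \<theta> - y w)))" for n
      by (simp add: yukawa_def right_diff_distrib exp_diff exp_minus field_simps)
    define c q where "c = \<theta> \<bullet> y w" and "q = y w \<bullet> y w"
    have n: "norm (l n *\<^sub>R \<theta> - y w) = sqrt ((l n)\<^sup>2 - 2 * l n * c + q)" for n
      unfolding norm_eq_sqrt_inner c_def q_def
      by (simp add: inner_diff_left inner_diff_right \<theta>\<theta> inner_commute power2_eq_square algebra_simps)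
    have l_top: "filterlim l at_top sequentially" unfolding l_def by real_asymp
    have "((\<lambda>r. r / sqrt (r\<^sup>2 - 2 * r * c + q)) \<longlongrightarrow> 1) at_top" by real_asymp
    from filterlim_compose[OF this l_top]
    have "(\<lambda>n. l n / sqrt ((l n)\<^sup>2 - 2 * l n * c + q)) \<longlonglongrightarrow> 1" .
    moreover have "((\<lambda>r. r - sqrt (r\<^sup>2 - 2 * r * c + q)) \<longlongrightarrow> c) at_top" by real_asymp
    from filterlim_compose[OF this l_top]
    have "(\<lambda>n. l n - sqrt ((l n)\<^sup>2 - 2 * l n * c + q)) \<longlonglongrightarrow> c" .
    ultimately have "(\<lambda>n. (l n / norm (l n *\<^sub>R \<theta> - y w)) * exp (p * (l n - norm (l n *\<^sub>R \<theta> - y w)))) \<longlonglongrightarrow> 1 * exp (p * c)"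
      unfolding n by (intro tendsto_intros)
    then show "(\<lambda>n. ?k n w) \<longlonglongrightarrow> exp (p * (\<theta> \<bullet> y w))" unfolding k c_def by simp
    show "\<bar>?k n w\<bar> \<le> (1 + \<rho>) * exp (p * \<rho>)" for n
    proof -
      have "l n \<le> (1 + \<rho>) * (l n - \<rho>)"
      proof -
        have "0 \<le> \<rho> * (l n - \<rho> - 1)" using l[of n] R \<rho> by (intro mult_nonneg_nonneg) auto
        then show ?thesis by (simp add: algebra_simps)
      qed
      also have "\<dots> \<le> (1 + \<rho>) * norm (l n *\<^sub>R \<theta> - y w)" using d(1)[of n] \<rho> by (intro mult_left_mono) auto
      finally have "l n / norm (l n *\<^sub>R \<theta> - y w) \<le> 1 + \<rho>"
        using d(1)[of n] l[of n] R \<rho> by (subst pos_divide_le_eq) auto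
      then show ?thesis unfolding k abs_mult
        using d(2)[of n] p l[of n] R \<rho> by (intro mult_mono) auto
    qed
  qed measurable
  have eq: "(\<integral>w. g w * ?k n w \<partial>M) = l n * exp (p * l n) * potential (l n *\<^sub>R \<theta>)" for n
    unfolding potential_def by (subst integral_mult_right_zero[symmetric]) (simp add: mult_ac)
  have "(\<integral>w. g w * ?k n w \<partial>M) \<le> C * R * exp (p * R)" for n
  proof -
    have "potential (l n *\<^sub>R \<theta>) \<le> C * R * exp (p * R) * yukawa p (l n *\<^sub>R \<theta>)"
    proof (rule potential_le_barrier[OF R C])
      show "R \<le> norm (l n *\<^sub>R \<theta>)" unfolding nl using l[of n] \<rho> by linarith
    qed
    then have "l n * exp (p * l n) * potential (l n *\<^sub>R \<theta>) \<le> l n * exp (p * l n) * (C * R * exp (p * R) * yukawa p (l n *\<^sub>R \<theta>))"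
      using l[of n] R \<rho> by (intro mult_left_mono) auto
    also have "\<dots> = C * R * exp (p * R)"
      unfolding yukawa_def nl using l[of n] R \<rho> by (simp add: exp_minus)
    finally show ?thesis unfolding eq .
  qed
  then show ?thesis by (intro LIMSEQ_le_const2[OF lim]) auto
qed

end

lemma abs_far_field_le:
  fixes g :: "'b \<Rightarrow> real" and y :: "'b \<Rightarrow> 'a::euclidean_space"
  assumes g: "integrable M g" and y[measurable]: "y \<in> borel_measurable M"
    and supp: "\<And>w. w \<in> space M \<Longrightarrow> g w \<noteq> 0 \<Longrightarrow> norm (y w) \<le> \<rho>"
    and p: "p > 0" and dim: "DIM('a) = 3" and \<rho>: "\<rho> \<ge> 0" "R > \<rho>"
    and C: "\<And>x. norm x = R \<Longrightarrow> \<bar>\<integral>w. g w * yukawa p (x - y w) \<partial>M\<bar> \<le> C" and \<theta>: "norm \<theta> = 1"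
  shows "\<bar>\<integral>w. g w * exp (p * (\<theta> \<bullet> y w)) \<partial>M\<bar> \<le> C * R * exp (p * R)"
proof -
  interpret pos: yukawa_potential M g y p \<rho>
    by unfold_locales (use assms in auto)
  interpret neg: yukawa_potential M "\<lambda>w. - g w" y p \<rho>
    by unfold_locales (use assms in auto)
  have "(\<integral>w. g w * exp (p * (\<theta> \<bullet> y w)) \<partial>M) \<le> C * R * exp (p * R)"
    by (rule pos.far_field_le[OF \<rho>(2) _ \<theta>]) (use C in \<open>auto simp: pos.potential_def abs_le_iff\<close>)
  moreover have "(\<integral>w. - g w * exp (p * (\<theta> \<bullet> y w)) \<partial>M) \<le> C * R * exp (p * R)"
    by (rule neg.far_field_le[OF \<rho>(2) _ \<theta>]) (use C in \<open>auto simp: neg.potential_def abs_le_iff\<close>)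
  ultimately show ?thesis by (simp add: abs_le_iff)
qed

section \<open>Shears and the splitting of space into horizontal and vertical parts\<close>

text \<open>The change of variables from emission times \<open>s\<close> to arrival times \<open>t = s + b(y)\<close>: on every fibre
  it is a translation.\<close>

lemma distr_lborel_shear:
  fixes b :: "'a::euclidean_space \<Rightarrow> real"
  assumes [measurable]: "b \<in> borel_measurable borel"
  shows "distr lborel lborel (\<lambda>(y, s). (y, s + b y)) = (lborel :: ('a \<times> real) measure)"
proof (rule measure_eqI)
  fix A assume "A \<in> sets (distr lborel lborel (\<lambda>(y::'a, s). (y, s + b y)))"
  then have A[measurable]: "A \<in> sets (borel :: ('a \<times> real) measure)" by simp
  have [measurable]: "(\<lambda>(y::'a, s). (y, s + b y)) \<in> borel \<rightarrow>\<^sub>M borel"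
    unfolding borel_prod[symmetric] by measurable
  have [measurable]: "A \<in> sets (borel \<Otimes>\<^sub>M borel)" using A unfolding borel_prod .
  have "emeasure (distr lborel lborel (\<lambda>(y::'a, s). (y, s + b y))) A
      = (\<integral>\<^sup>+w. indicator A w \<partial>distr lborel lborel (\<lambda>(y::'a, s). (y, s + b y)))"
    by simp
  also have "\<dots> = (\<integral>\<^sup>+w. indicator A (case w of (y, s) \<Rightarrow> (y, s + b y)) \<partial>(lborel \<Otimes>\<^sub>M lborel))"
    by (subst nn_integral_distr) (auto simp: lborel_prod)
  also have "\<dots> = (\<integral>\<^sup>+y. \<integral>\<^sup>+s. indicator A (y, s + b y) \<partial>lborel \<partial>lborel)"
    by (subst lborel.nn_integral_fst[symmetric]) auto
  also have "\<dots> = (\<integral>\<^sup>+y. \<integral>\<^sup>+s. indicator A (y, s) \<partial>lborel \<partial>lborel)"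
  proof (rule nn_integral_cong)
    fix y :: 'a
    show "(\<integral>\<^sup>+s. indicator A (y, s + b y) \<partial>lborel) = (\<integral>\<^sup>+s. indicator A (y, s) \<partial>lborel)"
      using nn_integral_real_affine[of "\<lambda>s. indicator A (y, s)" 1 "b y"] by (simp add: add.commute)
  qed
  also have "\<dots> = (\<integral>\<^sup>+w. indicator A w \<partial>(lborel \<Otimes>\<^sub>M lborel))"
    by (rule lborel.nn_integral_fst) measurable
  also have "\<dots> = emeasure lborel A" by (simp add: lborel_prod)
  finally show "emeasure (distr lborel lborel (\<lambda>(y::'a, s). (y, s + b y))) A = emeasure lborel A" .
qed simp

text \<open>Null sets of space-time are invisible to retarded integrals at almost every time, although the
  surface \<open>{(y, t - b y)}\<close> is a null set itself for each single \<open>t\<close>.\<close>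

lemma AE_lborel_slices:
  fixes b :: "'a::euclidean_space \<Rightarrow> real"
  assumes [measurable]: "b \<in> borel_measurable borel" "N \<in> sets borel"
    and ae: "AE w in lborel. w \<notin> (N :: ('a \<times> real) set)"
  shows "AE t in lborel. AE y in lborel. (y, t - b y) \<notin> N"
proof -
  have [measurable]: "N \<in> sets (borel \<Otimes>\<^sub>M borel)" using assms(2) unfolding borel_prod .
  have m[measurable]: "(\<lambda>(y::'a, s). (y, s - b y)) \<in> lborel \<rightarrow>\<^sub>M lborel"
    unfolding lborel_prod[symmetric] by measurable
  have sh: "distr lborel lborel (\<lambda>(y::'a, s). (y, s - b y)) = lborel"
    using distr_lborel_shear[of "\<lambda>y. - b y"] by simp
  have "AE w in distr lborel lborel (\<lambda>(y::'a, s). (y, s - b y)). w \<notin> N"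
    unfolding sh by (rule ae)
  then have "AE w in lborel. (case w of (y, s) \<Rightarrow> (y, s - b y)) \<notin> N"
    by (subst (asm) AE_distr_iff[OF m]) auto
  then have "AE w in (lborel \<Otimes>\<^sub>M lborel). (fst w, snd w - b (fst w)) \<notin> N"
    unfolding lborel_prod by (simp add: case_prod_beta)
  from lborel_pair.AE_pair[OF this]
  have "AE y in lborel. AE t in lborel. (y, t - b y) \<notin> N" by simp
  moreover have "{w \<in> space (lborel \<Otimes>\<^sub>M lborel). (fst w, snd w - b (fst w)) \<notin> N} \<in> sets (lborel \<Otimes>\<^sub>M lborel)"
    by measurable
  ultimately show ?thesis
    using lborel_pair.AE_commute[of "\<lambda>y t. (y, t - b y) \<notin> N"] by blast
qed

lemma norm_horizontal: "(norm (y :: real^3))\<^sup>2 = (norm (horizontal y))\<^sup>2 + (y $ 3)\<^sup>2"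
  unfolding power2_norm_eq_inner by (simp add: inner_vec_def sum_2 sum_3 horizontal_def power2_eq_square)

lemma norm_le_sqrt2_if_cylinder:
  assumes "norm (horizontal y) \<le> r" "\<bar>y $ 3\<bar> \<le> r"
  shows "norm y \<le> sqrt 2 * r"
proof (rule power2_le_imp_le)
  have "(norm (horizontal y))\<^sup>2 \<le> r\<^sup>2" "(y $ 3)\<^sup>2 \<le> r\<^sup>2"
    using assms power_mono[of "\<bar>y $ 3\<bar>" r 2] by (auto intro: power_mono)
  then show "(norm y)\<^sup>2 \<le> (sqrt 2 * r)\<^sup>2" by (simp add: norm_horizontal power_mult_distrib)
  show "0 \<le> sqrt 2 * r" using order_trans[OF norm_ge_zero assms(1)] by simp
qed

lemma inner_horizontal: "(x :: real^3) \<bullet> y = horizontal x \<bullet> horizontal y + x $ 3 * y $ 3"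
  by (simp add: inner_vec_def sum_2 sum_3 horizontal_def)

lemma horizontal_vector: "horizontal (vector [a $ 1, a $ 2, c]) = a"
  by (simp add: horizontal_def vec_eq_iff forall_2)

lemma prod_inner_Basis_prod:
  fixes w :: "'a::euclidean_space \<times> 'b::euclidean_space"
  shows "(\<Prod>b\<in>Basis. w \<bullet> b) = (\<Prod>u\<in>Basis. fst w \<bullet> u) * (\<Prod>v\<in>Basis. snd w \<bullet> v)"
proof -
  have "inj_on (\<lambda>u. (u::'a, 0::'b)) Basis" "inj_on (\<lambda>v. (0::'a, v::'b)) Basis"
    by (auto intro!: inj_onI)
  then show ?thesis
    unfolding Basis_prod_def
    by (subst prod.union_disjoint) (auto simp: prod.reindex inner_prod_def)
qed

lemma prod_Basis_vec:
  fixes w :: "real ^ 'n"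
  shows "(\<Prod>b\<in>Basis. w \<bullet> b) = (\<Prod>i\<in>UNIV. w $ i)"
proof -
  have B: "(Basis :: (real^'n) set) = (\<lambda>i. axis i 1) ` UNIV"
    by (auto simp: Basis_vec_def)
  moreover have "inj (\<lambda>i::'n. axis i (1::real))"
    by (auto intro!: injI simp: axis_eq_axis)
  ultimately show ?thesis
    by (subst B, subst prod.reindex) (auto simp: inner_axis)
qed

text \<open>The arguments of a product source, \<open>((y',s),y\<^sub>3)\<close>, as a space-time point \<open>(y,s)\<close>. It is a permutation of coordinates,
  and integrals of product sources become product integrals in it.\<close>

definition assemble :: "((real^2) \<times> real) \<times> real \<Rightarrow> (real^3) \<times> real" where
  "assemble = (\<lambda>((a, s), c). (vector [a $ 1, a $ 2, c], s))"

lemma continuous_on_assemble: "continuous_on UNIV assemble"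
proof -
  have "vector [a, b, c] = a *\<^sub>R axis 1 1 + b *\<^sub>R axis 2 1 + c *\<^sub>R (axis 3 1 :: real^3)" for a b c :: real
    by (simp add: vec_eq_iff forall_3 axis_def)
  then have eq: "assemble = (\<lambda>w. (fst (fst w) $ 1 *\<^sub>R axis 1 1 + fst (fst w) $ 2 *\<^sub>R axis 2 1 + snd w *\<^sub>R axis 3 1, snd (fst w)))"
    by (auto simp: assemble_def fun_eq_iff)
  show ?thesis by (subst eq) (intro continuous_intros)
qed

lemma measurable_assemble[measurable]: "assemble \<in> borel \<rightarrow>\<^sub>M borel"
  using continuous_on_assemble by (rule borel_measurable_continuous_onI)

lemma distr_lborel_assemble: "distr lborel borel assemble = lborel"
proof (rule lborel_eqI[symmetric])
  fix l u :: "(real^3) \<times> real" assume lu: "\<And>b. b \<in> Basis \<Longrightarrow> l \<bullet> b \<le> u \<bullet> b"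
  define flat :: "(real^3) \<times> real \<Rightarrow> ((real^2) \<times> real) \<times> real" where "flat w = ((vector [fst w $ 1, fst w $ 2], snd w), fst w $ 3)" for w
  have box3: "box a b = {x. a $ 1 < x $ 1 \<and> x $ 1 < b $ 1 \<and> a $ 2 < x $ 2 \<and> x $ 2 < b $ 2 \<and> a $ 3 < x $ 3 \<and> x $ 3 < b $ 3}" for a b :: "real^3"
    by (auto simp: mem_box_cart forall_3)
  have box2: "box a b = {x. a $ 1 < x $ 1 \<and> x $ 1 < b $ 1 \<and> a $ 2 < x $ 2 \<and> x $ 2 < b $ 2}" for a b :: "real^2"
    by (auto simp: mem_box_cart forall_2)
  have boxP: "box a b = box (fst a) (fst b) \<times> box (snd a) (snd b)" for a b :: "'x::euclidean_space \<times> 'y::euclidean_space"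
    by (auto simp: mem_box Basis_prod_def ball_Un inner_prod_def)
  have pre: "assemble -` box l u = box (flat l) (flat u)"
    unfolding boxP box3 box2 by (auto simp: assemble_def flat_def case_prod_beta)
  have l1: "fst l $ i \<le> fst u $ i" for i
  proof -
    have "(axis i 1, 0) \<in> (Basis :: ((real^3) \<times> real) set)" by (auto simp: Basis_prod_def Basis_vec_def)
    from lu[OF this] show ?thesis by (simp add: inner_prod_def inner_axis)
  qed
  have l2: "snd l \<le> snd u"
    using lu[of "(0, 1)"] by (simp add: inner_prod_def Basis_prod_def)
  have le: "\<And>b. b \<in> Basis \<Longrightarrow> flat l \<bullet> b \<le> flat u \<bullet> b"
  proof -
    have "(vector [fst l $ 1, fst l $ 2] :: real^2) $ i \<le> (vector [fst u $ 1, fst u $ 2] :: real^2) $ i" for i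
      using exhaust_2[of i] l1 by auto
    then show "flat l \<bullet> b \<le> flat u \<bullet> b" if "b \<in> Basis" for b
      using that l1 l2 by (auto simp: Basis_prod_def Basis_vec_def flat_def inner_axis)
  qed
  have "emeasure (distr lborel borel assemble) (box l u) = emeasure lborel (box (flat l) (flat u))"
    by (subst emeasure_distr) (auto simp: pre)
  also have "\<dots> = (\<Prod>b\<in>Basis. (flat u - flat l) \<bullet> b)"
    by (rule emeasure_lborel_box[OF le])
  also have "(\<Prod>b\<in>Basis. (flat u - flat l) \<bullet> b) = (\<Prod>b\<in>Basis. (u - l) \<bullet> b)"
    unfolding prod_inner_Basis_prod prod_Basis_vec UNIV_2 UNIV_3 by (simp add: flat_def)
  finally show "emeasure (distr lborel borel assemble) (box l u) = (\<Prod>b\<in>Basis. (u - l) \<bullet> b)" .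
qed simp

lemma integrable_lborel_tensor:
  fixes F :: "'a::euclidean_space \<Rightarrow> complex" and G :: "'b::euclidean_space \<Rightarrow> complex"
  assumes F: "integrable lborel F" and G: "integrable lborel G"
  shows "integrable lborel (\<lambda>(x, y). F x * G y)"
    and "(\<integral>(x, y). F x * G y \<partial>lborel) = (\<integral>x. F x \<partial>lborel) * (\<integral>y. G y \<partial>lborel)"
proof -
  have [measurable]: "F \<in> borel_measurable borel" "G \<in> borel_measurable borel" using F G by auto
  have i: "integrable (lborel \<Otimes>\<^sub>M lborel) (\<lambda>(x, y). F x * G y)"
  proof (rule lborel_pair.Fubini_integrable)
    show "integrable lborel (\<lambda>x. \<integral>y. norm (case (x, y) of (x, y) \<Rightarrow> F x * G y) \<partial>lborel)"
      using F by (simp add: norm_mult)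
    show "AE x in lborel. integrable lborel (\<lambda>y. case (x, y) of (x, y) \<Rightarrow> F x * G y)"
      using G by simp
  qed measurable
  then show "integrable lborel (\<lambda>(x, y). F x * G y)" by (simp add: lborel_prod)
  have "(\<integral>(x, y). F x * G y \<partial>(lborel \<Otimes>\<^sub>M lborel)) = (\<integral>x. (\<integral>y. F x * G y \<partial>lborel) \<partial>lborel)"
    using lborel_pair.integral_fst[of "\<lambda>x y. F x * G y"] i by simp
  then show "(\<integral>(x, y). F x * G y \<partial>lborel) = (\<integral>x. F x \<partial>lborel) * (\<integral>y. G y \<partial>lborel)"
    by (simp add: lborel_prod)
qed

lemma continuous_on_horizontal: "continuous_on UNIV horizontal"
proof -
  have eq: "horizontal = (\<lambda>x. x $ 1 *\<^sub>R axis 1 1 + x $ 2 *\<^sub>R axis 2 1)"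
    by (simp add: fun_eq_iff horizontal_def vec_eq_iff forall_2 axis_def)
  show ?thesis by (subst eq) (intro continuous_intros)
qed

lemma measurable_horizontal_snd [measurable]:
  "(\<lambda>w :: (real^3) \<times> real. (horizontal (fst w), snd w)) \<in> borel \<rightarrow>\<^sub>M borel"
  by (intro borel_measurable_continuous_onI continuous_intros continuous_on_compose2[OF continuous_on_horizontal]) simp

lemma measurable_vertical_fst [measurable]:
  "(\<lambda>w :: (real^3) \<times> real. fst w $ 3) \<in> borel \<rightarrow>\<^sub>M borel"
  by (intro borel_measurable_continuous_onI continuous_intros)

text \<open>Exceptional sets of \<open>f\<close> and of \<open>h\<close> are null sets in \<open>(y',s)\<close> and in \<open>y\<^sub>3\<close>; together they make up a
  null set of space-time.\<close>

lemma AE_assemble: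
  assumes N: "N\<^sub>1 \<in> null_sets (lborel :: ((real^2) \<times> real) measure)" "N\<^sub>2 \<in> null_sets (lborel :: real measure)"
  shows "AE w in lborel. (horizontal (fst w), snd w) \<notin> N\<^sub>1 \<and> fst w $ 3 \<notin> N\<^sub>2"
proof -
  have [measurable]: "N\<^sub>1 \<in> sets borel" "N\<^sub>2 \<in> sets borel" using N by auto
  have "AE w in (lborel \<Otimes>\<^sub>M lborel). fst w \<notin> N\<^sub>1 \<and> snd w \<notin> N\<^sub>2"
  proof (rule lborel_pair.AE_pair_measure)
    show "{w \<in> space (lborel \<Otimes>\<^sub>M lborel). fst w \<notin> N\<^sub>1 \<and> snd w \<notin> N\<^sub>2} \<in> sets (lborel \<Otimes>\<^sub>M lborel)"
      by measurable
    show "AE u in lborel. AE c in lborel. fst (u, c) \<notin> N\<^sub>1 \<and> snd (u, c) \<notin> N\<^sub>2"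
      using AE_not_in[OF N(1)] by eventually_elim (use AE_not_in[OF N(2)] in simp)
  qed
  then have "AE w in lborel. (horizontal (fst (assemble w)), snd (assemble w)) \<notin> N\<^sub>1 \<and> fst (assemble w) $ 3 \<notin> N\<^sub>2"
    unfolding lborel_prod
  proof eventually_elim
    case (elim w)
    have "vector [a $ 1, a $ 2] = (a :: real^2)" for a by (simp add: vec_eq_iff forall_2)
    then show ?case using elim by (simp add: assemble_def horizontal_def case_prod_beta)
  qed
  then have "AE w in distr lborel borel assemble. (horizontal (fst w), snd w) \<notin> N\<^sub>1 \<and> fst w $ 3 \<notin> N\<^sub>2"
  proof (subst AE_distr_iff)
    show "{w \<in> space borel. (horizontal (fst w), snd w) \<notin> N\<^sub>1 \<and> fst w $ 3 \<notin> N\<^sub>2} \<in> sets borel"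
      by measurable
  qed auto
  then show ?thesis unfolding distr_lborel_assemble .
qed

section \<open>From boundary traces to plane-wave integrals\<close>

text \<open>With \<open>t = s + |x-y|\<close> the left-hand side is the integral over \<open>t\<close> of \<open>exp(-pt)\<close> times the trace at
  time \<open>t\<close>. Times \<open>t \<le> 0\<close> are not reached by the source, times in \<open>(0,T)\<close> do not contribute by
  hypothesis, and for later times \<open>exp(-pt) \<le> exp(-pT)\<close>.\<close>

lemma laplace_trace_bound:
  fixes \<Phi> :: "'a::euclidean_space \<times> real \<Rightarrow> complex"
  assumes \<Phi>: "integrable lborel \<Phi>"
    and supp: "\<And>y s. \<Phi> (y, s) \<noteq> 0 \<Longrightarrow> norm y \<le> \<rho> \<and> 0 \<le> s"
    and x: "norm x > \<rho>" and p: "p > 0"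
    and trace: "AE t in lborel. 0 < t \<longrightarrow> t < T \<longrightarrow> (\<integral>y. \<Phi> (y, t - norm (x - y)) / complex_of_real (norm (x - y)) \<partial>lborel) = 0"
  shows "norm (\<integral>w. complex_of_real (exp (- (p * snd w)) * yukawa p (x - fst w)) * \<Phi> w \<partial>lborel)
     \<le> (\<integral>w. norm (\<Phi> w) \<partial>lborel) / (norm x - \<rho>) * exp (- (p * T))"
proof -
  define b where "b y = norm (x - y)" for y
  have [measurable]: "b \<in> borel_measurable borel" unfolding b_def by measurable
  have [measurable]: "\<Phi> \<in> borel_measurable borel" using \<Phi> by simp
  then have [measurable]: "\<Phi> \<in> borel_measurable (borel \<Otimes>\<^sub>M borel)" unfolding borel_prod .
  define d where "d = norm x - \<rho>"
  have d: "d > 0" using x by (simp add: d_def)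
  have bd: "d \<le> b y" if "\<Phi> (y, s) \<noteq> 0" for y s
    using supp[OF that] norm_triangle_ineq2[of x y] by (simp add: b_def d_def)
  define sh where "sh = (\<lambda>(y::'a, s). (y, s + b y))"
  have sh_meas[measurable]: "sh \<in> lborel \<rightarrow>\<^sub>M lborel"
    unfolding sh_def lborel_prod[symmetric] by measurable
  have sh: "distr lborel lborel sh = lborel" unfolding sh_def by (rule distr_lborel_shear) measurable
  define F where "F = (\<lambda>w. norm (\<Phi> (fst w, snd w - b (fst w))))"
  define G where "G = (\<lambda>w. complex_of_real (exp (- (p * snd w)) / b (fst w)) * \<Phi> (fst w, snd w - b (fst w)))"
  have F_meas[measurable]: "F \<in> borel_measurable (lborel \<Otimes>\<^sub>M lborel)" unfolding F_def by measurable
  have G_meas[measurable]: "G \<in> borel_measurable (lborel \<Otimes>\<^sub>M lborel)" unfolding G_def by measurable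
  have F_meas': "F \<in> borel_measurable lborel" "G \<in> borel_measurable lborel"
    using F_meas G_meas by (simp_all add: lborel_prod)
  have sh_borel: "sh \<in> borel \<rightarrow>\<^sub>M borel" using sh_meas by simp
  have F_sh: "F (sh w) = norm (\<Phi> w)" for w by (simp add: F_def sh_def case_prod_beta)
  \<comment> \<open>The integrand \<open>G\<close> in the variables \<open>(y,t)\<close>, pulled back along the shear, is the integrand in \<open>(y,s)\<close>.\<close>
  have G_sh: "G (sh w) = complex_of_real (exp (- (p * snd w)) * yukawa p (x - fst w)) * \<Phi> w" for w
    by (simp add: G_def sh_def case_prod_beta yukawa_def b_def distrib_left exp_diff exp_add exp_minus divide_inverse mult_ac)
  have iF: "integrable lborel F"
    by (subst sh[symmetric], subst integrable_distr_eq) (use F_meas' sh_borel \<Phi> in \<open>auto simp: F_sh\<close>)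
  have GF: "norm (G w) \<le> 1 / d * F w" for w
  proof (cases "\<Phi> (fst w, snd w - b (fst w)) = 0")
    case False
    have "d \<le> b (fst w)" "0 \<le> snd w" using bd[OF False] supp[OF False] d by (auto simp: b_def)
    then have "exp (- (p * snd w)) / b (fst w) \<le> 1 / d" using d p by (intro frac_le) auto
    then show ?thesis using \<open>d \<le> b (fst w)\<close> d
      unfolding G_def F_def norm_mult norm_of_real by (intro mult_right_mono) auto
  qed (simp add: G_def F_def)
  have iG: "integrable lborel G"
    by (rule Bochner_Integration.integrable_bound[where f = "\<lambda>w. 1 / d * F w"])
      (use iF GF F_meas' d in \<open>auto simp: F_def\<close>)
  have F2: "integrable (lborel \<Otimes>\<^sub>M lborel) (\<lambda>(y, t). F (y, t))" and G2: "integrable (lborel \<Otimes>\<^sub>M lborel) (\<lambda>(y, t). G (y, t))"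
    using iF iG by (simp_all add: lborel_prod)
  have "(\<integral>w. complex_of_real (exp (- (p * snd w)) * yukawa p (x - fst w)) * \<Phi> w \<partial>lborel) = (\<integral>w. G (sh w) \<partial>lborel)"
    unfolding G_sh ..
  also have "\<dots> = (\<integral>w. G w \<partial>distr lborel lborel sh)"
    by (rule integral_distr[symmetric]) (use F_meas' sh_borel in auto)
  also have "\<dots> = (\<integral>w. G w \<partial>(lborel \<Otimes>\<^sub>M lborel))" by (simp add: sh lborel_prod)
  also have "\<dots> = (\<integral>t. (\<integral>y. G (y, t) \<partial>lborel) \<partial>lborel)"
    using lborel_pair.integral_snd[OF G2] by simp
  finally have 1: "(\<integral>w. complex_of_real (exp (- (p * snd w)) * yukawa p (x - fst w)) * \<Phi> w \<partial>lborel)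
    = (\<integral>t. (\<integral>y. G (y, t) \<partial>lborel) \<partial>lborel)" .
  have "norm (\<integral>t. (\<integral>y. G (y, t) \<partial>lborel) \<partial>lborel) \<le> (\<integral>t. exp (- (p * T)) / d * (\<integral>y. F (y, t) \<partial>lborel) \<partial>lborel)"
  proof (rule order_trans[OF integral_norm_bound integral_mono_AE])
    show "integrable lborel (\<lambda>t. norm (\<integral>y. G (y, t) \<partial>lborel))"
      using lborel_pair.integrable_snd[OF G2] by simp
    show "integrable lborel (\<lambda>t. exp (- (p * T)) / d * (\<integral>y. F (y, t) \<partial>lborel))"
      using lborel_pair.integrable_snd[OF F2] by simp
    have F_nonneg: "0 \<le> (\<integral>y. F (y, t) \<partial>lborel)" for t
      by (rule integral_nonneg_AE) (simp add: F_def)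
    show "AE t in lborel. norm (\<integral>y. G (y, t) \<partial>lborel) \<le> exp (- (p * T)) / d * (\<integral>y. F (y, t) \<partial>lborel)"
      using trace lborel_pair.AE_integrable_snd[OF F2] lborel_pair.AE_integrable_snd[OF G2]
    proof eventually_elim
      case (elim t)
      consider "t \<le> 0" | "0 < t" "t < T" | "T \<le> t" by linarith
      then show ?case
      proof cases
        case 1
        have "G (y, t) = 0" for y
        proof (rule ccontr)
          assume "G (y, t) \<noteq> 0"
          then have "\<Phi> (y, t - b y) \<noteq> 0" by (auto simp: G_def)
          from bd[OF this] supp[OF this] d 1 show False by linarith
        qed
        then show ?thesis using F_nonneg[of t] d by simp
      next
        case 2
        have "(\<integral>y. G (y, t) \<partial>lborel) = (\<integral>y. complex_of_real (exp (- (p * t))) * (\<Phi> (y, t - norm (x - y)) / complex_of_real (norm (x - y))) \<partial>lborel)"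
          by (simp add: G_def b_def divide_inverse mult_ac)
        also have "\<dots> = 0" using elim(1) 2 by (subst integral_mult_right_zero) simp
        finally show ?thesis using F_nonneg[of t] d by simp
      next
        case 3
        have "norm (\<integral>y. G (y, t) \<partial>lborel) \<le> (\<integral>y. exp (- (p * T)) / d * F (y, t) \<partial>lborel)"
        proof (rule order_trans[OF integral_norm_bound integral_mono])
          show "integrable lborel (\<lambda>y. norm (G (y, t)))" using elim(3) by simp
          show "integrable lborel (\<lambda>y. exp (- (p * T)) / d * F (y, t))" using elim(2) by simp
          fix y
          show "norm (G (y, t)) \<le> exp (- (p * T)) / d * F (y, t)"
          proof (cases "\<Phi> (y, t - b y) = 0")
            case False
            have "d \<le> b y" using bd[OF False] .
            then have "exp (- (p * t)) / b y \<le> exp (- (p * T)) / d" using d p 3 by (intro frac_le) auto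
            then show ?thesis using \<open>d \<le> b y\<close> d
              unfolding G_def F_def norm_mult norm_of_real fst_conv snd_conv by (intro mult_right_mono) auto
          qed (simp add: G_def F_def)
        qed
        then show ?thesis by simp
      qed
    qed
  qed
  also have "\<dots> = exp (- (p * T)) / d * (\<integral>t. (\<integral>y. F (y, t) \<partial>lborel) \<partial>lborel)" by simp
  also have "(\<integral>t. (\<integral>y. F (y, t) \<partial>lborel) \<partial>lborel) = (\<integral>w. F w \<partial>lborel)"
    using lborel_pair.integral_snd[OF F2] by (simp add: lborel_prod)
  also have "\<dots> = (\<integral>w. F w \<partial>distr lborel lborel sh)" by (simp add: sh)
  also have "\<dots> = (\<integral>w. norm (\<Phi> w) \<partial>lborel)"
    by (subst integral_distr) (use F_meas' sh_borel in \<open>auto simp: F_sh\<close>)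
  finally show ?thesis unfolding 1 by (simp add: d_def mult_ac)
qed

text \<open>The far field bound gives decay at the rate \<open>T - R\<close>, whereas the exponent \<open>\<theta>\<cdot>y - s\<close> is bounded
  below by \<open>-c > -(T-R)\<close> on the support. The real and the imaginary part of the source are treated separately, through the
  bounded linear functional \<open>L\<close>.\<close>

theorem plane_wave_integrals_zero:
  fixes \<Phi> :: "'a::euclidean_space \<times> real \<Rightarrow> complex"
  assumes dim: "DIM('a) = 3" and \<Phi>: "integrable lborel \<Phi>"
    and supp: "\<And>y s. \<Phi> (y, s) \<noteq> 0 \<Longrightarrow> norm y \<le> \<rho> \<and> 0 \<le> s" and \<rho>: "0 \<le> \<rho>" "\<rho> < R"
    and trace: "\<And>x. norm x = R \<Longrightarrow> AE t in lborel. 0 < t \<longrightarrow> t < T \<longrightarrow>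
       (\<integral>y. \<Phi> (y, t - norm (x - y)) / complex_of_real (norm (x - y)) \<partial>lborel) = 0"
    and \<theta>: "norm \<theta> = 1"
    and late: "\<And>y s. \<Phi> (y, s) \<noteq> 0 \<Longrightarrow> s - \<theta> \<bullet> y \<le> c" and c: "c < T - R"
  shows "(\<integral>w. complex_of_real (exp (l * (\<theta> \<bullet> fst w - snd w))) * \<Phi> w \<partial>lborel) = 0"
proof -
  define C where "C = (\<integral>w. norm (\<Phi> w) \<partial>lborel) / (R - \<rho>)"
  have [measurable]: "\<Phi> \<in> borel_measurable borel" using \<Phi> by simp
  have part: "(\<integral>w. exp (l * (\<theta> \<bullet> fst w - snd w)) * L (\<Phi> w) \<partial>lborel) = 0"
    if L: "bounded_linear L" "\<And>r z. L (complex_of_real r * z) = r * L z" "\<And>z. \<bar>L z\<bar> \<le> norm z" for L :: "complex \<Rightarrow> real"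
  proof -
    have L0: "L 0 = 0" using L(3)[of 0] by simp
    have iL: "integrable lborel (\<lambda>w. L (\<Phi> w))" by (rule integrable_bounded_linear[OF L(1) \<Phi>])
    have [measurable]: "L \<in> borel_measurable borel"
      using L(1) by (intro borel_measurable_continuous_onI linear_continuous_on)
    have nz: "\<Phi> w \<noteq> 0" if "L (\<Phi> w) \<noteq> 0" for w using that L0 by metis
    have bnd: "\<bar>\<theta> \<bullet> y\<bar> \<le> \<rho>" if "\<Phi> (y, s) \<noteq> 0" for y s
      using supp[OF that] Cauchy_Schwarz_ineq2[of \<theta> y] \<theta> by simp
    show ?thesis
    proof (rule exp_transform_zero_if_decays[where A = "-c" and B = \<rho> and m = "R - T" and C = "C * R"])
      show "sigma_finite_measure (lborel :: ('a \<times> real) measure)" by (rule lborel.sigma_finite_measure_axioms)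
      show "- c \<le> \<theta> \<bullet> fst w - snd w" if "L (\<Phi> w) \<noteq> 0" for w
        using late[of "fst w" "snd w"] nz[OF that] by simp
      show "\<theta> \<bullet> fst w - snd w \<le> \<rho>" if "L (\<Phi> w) \<noteq> 0" for w
        using bnd[of "fst w" "snd w"] supp[of "fst w" "snd w"] nz[OF that] by (auto simp: abs_le_iff)
      show "R - T < - c" using c by simp
      show "(\<lambda>w. \<theta> \<bullet> fst w - snd w) \<in> borel_measurable (lborel :: ('a \<times> real) measure)"
        by (simp add: borel_measurable_continuous_onI continuous_intros)
      fix p :: real assume p: "p > 0"
      define g where "g w = exp (- (p * snd w)) * L (\<Phi> w)" for w
      have gi: "integrable lborel g"
      proof (rule Bochner_Integration.integrable_bound[OF iL])
        have "(\<lambda>w :: 'a \<times> real. exp (- (p * snd w))) \<in> borel_measurable borel"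
          by (intro borel_measurable_continuous_onI continuous_intros)
        then show "g \<in> borel_measurable lborel" unfolding g_def using iL by simp
        have "norm (g w) \<le> norm (L (\<Phi> w))" for w
        proof (cases "L (\<Phi> w) = 0")
          case False
          then have "0 \<le> snd w" using supp[of "fst w" "snd w"] nz[OF False] by simp
          then show ?thesis using p by (simp add: g_def abs_mult mult_left_le_one_le)
        qed (simp add: g_def)
        then show "AE w in lborel. norm (g w) \<le> norm (L (\<Phi> w))" by simp
      qed
      have bound: "\<bar>\<integral>w. g w * yukawa p (x - fst w) \<partial>lborel\<bar> \<le> C * exp (- (p * T))" if x: "norm x = R" for x
      proof -
        let ?I = "\<lambda>w. complex_of_real (exp (- (p * snd w)) * yukawa p (x - fst w)) * \<Phi> w"
        have ym[measurable]: "(\<lambda>w. yukawa p (x - fst w)) \<in> borel_measurable (borel :: ('a \<times> real) measure)"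
        proof -
          have [measurable]: "fst \<in> borel_measurable (borel :: ('a \<times> real) measure)"
            by (intro borel_measurable_continuous_onI continuous_intros)
          show ?thesis unfolding yukawa_def by measurable
        qed
        have I: "integrable lborel ?I"
        proof (rule Bochner_Integration.integrable_bound[where f = "\<lambda>w. 1 / (R - \<rho>) * norm (\<Phi> w)"])
          have [measurable]: "snd \<in> borel_measurable (borel :: ('a \<times> real) measure)"
            by (intro borel_measurable_continuous_onI continuous_intros)
          have "?I \<in> borel_measurable borel" by measurable
          then show "?I \<in> borel_measurable lborel" by simp
          have "norm (?I w) \<le> 1 / (R - \<rho>) * norm (\<Phi> w)" for w
          proof (cases "\<Phi> w = 0")
            case False
            then have w: "0 \<le> snd w" "norm (fst w) \<le> \<rho>" using supp[of "fst w" "snd w"] by auto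
            have "\<bar>exp (- (p * snd w))\<bar> * \<bar>yukawa p (x - fst w)\<bar> \<le> 1 * (1 / (R - \<rho>))"
              using w p \<rho> x norm_triangle_ineq2[of x "fst w"] by (intro mult_mono abs_yukawa_le) auto
            then show ?thesis unfolding norm_mult norm_of_real abs_mult by (intro mult_right_mono) auto
          qed simp
          then show "AE w in lborel. norm (?I w) \<le> norm (1 / (R - \<rho>) * norm (\<Phi> w))"
            using \<rho> by simp
        qed (use \<Phi> in simp)
        have "(\<integral>w. g w * yukawa p (x - fst w) \<partial>lborel) = (\<integral>w. L (?I w) \<partial>lborel)"
          unfolding g_def L(2) by (simp add: mult_ac)
        also have "\<dots> = L (\<integral>w. ?I w \<partial>lborel)"
          by (rule integral_bounded_linear[OF L(1) I])
        finally have "\<bar>\<integral>w. g w * yukawa p (x - fst w) \<partial>lborel\<bar> \<le> norm (\<integral>w. ?I w \<partial>lborel)"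
          using L(3) by simp
        also have "\<dots> \<le> C * exp (- (p * T))"
          using laplace_trace_bound[OF \<Phi> _ _ p trace[OF x], of \<rho>] supp \<rho> x by (simp add: C_def)
        finally show ?thesis .
      qed
      have "\<bar>\<integral>w. g w * exp (p * (\<theta> \<bullet> fst w)) \<partial>lborel\<bar> \<le> C * exp (- (p * T)) * R * exp (p * R)"
      proof (rule abs_far_field_le[OF gi _ _ p dim \<rho>(1) \<rho>(2) bound \<theta>])
        show "norm (fst w) \<le> \<rho>" if "g w \<noteq> 0" for w
          using that supp[of "fst w" "snd w"] nz[of w] by (auto simp: g_def)
        have "fst \<in> borel_measurable (borel :: ('a \<times> real) measure)"
          by (intro borel_measurable_continuous_onI continuous_intros)
        then show "fst \<in> borel_measurable (lborel :: ('a \<times> real) measure)" by simp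
      qed
      moreover have "g w * exp (p * (\<theta> \<bullet> fst w)) = exp (p * (\<theta> \<bullet> fst w - snd w)) * L (\<Phi> w)" for w
        by (simp add: g_def right_diff_distrib exp_diff exp_minus divide_inverse mult_ac)
      moreover have "C * exp (- (p * T)) * R * exp (p * R) = C * R * exp (p * (R - T))"
        by (simp add: right_diff_distrib exp_diff exp_minus divide_inverse mult_ac)
      ultimately show "\<bar>\<integral>w. exp (p * (\<theta> \<bullet> fst w - snd w)) * L (\<Phi> w) \<partial>lborel\<bar> \<le> C * R * exp (p * (R - T))"
        by simp
    qed (rule iL)
  qed
  let ?I = "\<lambda>w. complex_of_real (exp (l * (\<theta> \<bullet> fst w - snd w))) * \<Phi> w"
  show ?thesis
  proof (cases "integrable lborel ?I")
    case True
    have "Re (\<integral>w. ?I w \<partial>lborel) = (\<integral>w. Re (?I w) \<partial>lborel)" "Im (\<integral>w. ?I w \<partial>lborel) = (\<integral>w. Im (?I w) \<partial>lborel)"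
      by (rule integral_bounded_linear[symmetric, OF _ True], rule bounded_linear_Re bounded_linear_Im)+
    then show ?thesis
      using part[OF bounded_linear_Re] part[OF bounded_linear_Im]
      by (simp add: complex_eq_iff abs_Re_le_cmod abs_Im_le_cmod)
  qed (simp add: not_integrable_integral_eq)
qed

text \<open>Retarded integrals depend linearly on the source only at times at which they converge; elsewhere
  they have a default value.\<close>

lemma AE_integrable_retarded:
  fixes \<Phi> :: "'a::euclidean_space \<times> real \<Rightarrow> complex"
  assumes \<Phi>: "integrable lborel \<Phi>" and supp: "\<And>y s. \<Phi> (y, s) \<noteq> 0 \<Longrightarrow> norm y \<le> \<rho>" and x: "norm x > \<rho>"
  shows "AE t in lborel. integrable lborel (\<lambda>y. \<Phi> (y, t - norm (x - y)) / complex_of_real (norm (x - y)))"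
proof -
  define b where "b y = norm (x - y)" for y
  have [measurable]: "b \<in> borel_measurable borel" unfolding b_def by measurable
  have [measurable]: "\<Phi> \<in> borel_measurable borel" using \<Phi> by simp
  then have [measurable]: "\<Phi> \<in> borel_measurable (borel \<Otimes>\<^sub>M borel)" unfolding borel_prod .
  define sh where "sh = (\<lambda>(y::'a, s). (y, s + b y))"
  have sh_meas: "sh \<in> lborel \<rightarrow>\<^sub>M lborel"
    unfolding sh_def lborel_prod[symmetric] by measurable
  have sh: "distr lborel lborel sh = lborel" unfolding sh_def by (rule distr_lborel_shear) measurable
  have meas: "(\<lambda>(y, t). \<Phi> (y, t - b y)) \<in> borel_measurable (lborel \<Otimes>\<^sub>M lborel)" by measurable
  have "integrable (distr lborel lborel sh) (\<lambda>(y, t). \<Phi> (y, t - b y))"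
  proof (subst integrable_distr_eq[OF sh_meas])
    show "(\<lambda>(y, t). \<Phi> (y, t - b y)) \<in> borel_measurable lborel" using meas by (simp add: lborel_prod)
    show "integrable lborel (\<lambda>w. case sh w of (y, t) \<Rightarrow> \<Phi> (y, t - b y))"
      using \<Phi> by (simp add: sh_def case_prod_beta)
  qed
  then have "integrable (lborel \<Otimes>\<^sub>M lborel) (\<lambda>(y, t). \<Phi> (y, t - b y))" by (simp add: sh lborel_prod)
  from lborel_pair.AE_integrable_snd[OF this] show ?thesis
  proof eventually_elim
    case (elim t)
    have m: "(\<lambda>y. \<Phi> (y, t - b y)) \<in> borel_measurable borel" using elim by simp
    show ?case unfolding b_def[symmetric]
    proof (rule Bochner_Integration.integrable_bound[where f = "\<lambda>y. \<Phi> (y, t - b y) / complex_of_real (norm x - \<rho>)"])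
      show "(\<lambda>y. \<Phi> (y, t - b y) / complex_of_real (b y)) \<in> borel_measurable lborel" using m by measurable
      have "norm (\<Phi> (y, t - b y) / complex_of_real (b y)) \<le> norm (\<Phi> (y, t - b y) / complex_of_real (norm x - \<rho>))" for y
      proof (cases "\<Phi> (y, t - b y) = 0")
        case False
        then have "norm x - \<rho> \<le> b y"
          using supp[OF False] norm_triangle_ineq2[of x y] by (simp add: b_def)
        then show ?thesis using x by (auto simp: norm_divide simp del: of_real_diff intro!: divide_left_mono mult_pos_pos)
      qed simp
      then show "AE y in lborel. norm (\<Phi> (y, t - b y) / complex_of_real (b y)) \<le> norm (\<Phi> (y, t - b y) / complex_of_real (norm x - \<rho>))"
        by simp
    qed (use elim in simp)
  qed
qed

section \<open>Sources that are products\<close>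

lemma integral_tensor_source:
  fixes f :: "(real^2) \<times> real \<Rightarrow> complex" and h :: "real \<Rightarrow> complex"
  assumes f: "integrable lborel f" and h: "integrable lborel h"
  defines "\<Phi> \<equiv> \<lambda>w :: (real^3) \<times> real. f (horizontal (fst w), snd w) * h (fst w $ 3)"
  shows "integrable lborel \<Phi>" and "(\<integral>w. \<Phi> w \<partial>lborel) = (\<integral>u. f u \<partial>lborel) * (\<integral>c. h c \<partial>lborel)"
proof -
  have [measurable]: "f \<in> borel_measurable borel" "h \<in> borel_measurable borel" using f h by auto
  have \<Phi>[measurable]: "\<Phi> \<in> borel_measurable borel" unfolding \<Phi>_def by measurable
  have eq: "\<Phi> (assemble w) = (case w of (u, c) \<Rightarrow> f u * h c)" for w
    by (auto simp: \<Phi>_def assemble_def horizontal_vector case_prod_beta)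
  have "integrable (distr lborel borel assemble) \<Phi>"
    by (subst integrable_distr_eq) (use integrable_lborel_tensor(1)[OF f h] in \<open>auto simp: eq\<close>)
  then show "integrable lborel \<Phi>" by (simp add: distr_lborel_assemble)
  have "(\<integral>w. \<Phi> w \<partial>distr lborel borel assemble) = (\<integral>w. \<Phi> (assemble w) \<partial>lborel)"
    by (rule integral_distr) auto
  then show "(\<integral>w. \<Phi> w \<partial>lborel) = (\<integral>u. f u \<partial>lborel) * (\<integral>c. h c \<partial>lborel)"
    using integrable_lborel_tensor(2)[OF f h] by (simp add: distr_lborel_assemble eq)
qed

text \<open>The exponents \<open>w = (\<xi>,\<tau>)\<close> of the open set \<open>U\<close> are those of the form \<open>(l\<theta>', -l)\<close>, \<open>l > 0\<close>, for a unit
  vector \<open>\<theta> = (\<theta>',\<theta>\<^sub>3)\<close>, with two further conditions: \<open>\<theta>\<close> is close enough to horizontal for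
  \<open>s - \<theta>\<cdot>y\<close> to stay below \<open>T\<^sub>0 + R\<^sub>0\<close> on the support, and the Laplace transform of \<open>h\<close> does not vanish at \<open>l\<theta>\<^sub>3\<close>.
  Given \<open>w\<close>, \<open>l|\<theta>\<^sub>3|\<close> is \<open>q(w) = \<surd>(\<tau>\<^sup>2 - |\<xi>|\<^sup>2)\<close>; the sign of \<open>\<theta>\<^sub>3\<close> is free and is taken from \<open>\<eta>\<^sub>0\<close>.\<close>

theorem tensor_source_zero:
  fixes f :: "(real^2) \<times> real \<Rightarrow> complex" and h :: "real \<Rightarrow> complex"
  assumes f: "integrable lborel f" "\<And>w. w \<notin> cball 0 r \<times> {0..T\<^sub>0} \<Longrightarrow> f w = 0"
    and h: "integrable lborel h" "\<And>c. \<bar>c\<bar> > r \<Longrightarrow> h c = 0" "\<not> (AE c in lborel. h c = 0)"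
    and r: "0 < r" "r < R\<^sub>0" "sqrt 2 * r < R" and T: "T\<^sub>0 + R\<^sub>0 \<le> T - R"
    and trace: "\<And>x :: real^3. norm x = R \<Longrightarrow> AE t in lborel. 0 < t \<longrightarrow> t < T \<longrightarrow>
       (\<integral>y. (f (horizontal y, t - norm (x - y)) * h (y $ 3)) / complex_of_real (norm (x - y)) \<partial>lborel) = 0"
  shows "AE w in lborel. f w = 0"
proof -
  define Lf where "Lf a = (\<integral>u. complex_of_real (exp (a \<bullet> u)) * f u \<partial>lborel)" for a
  define Lh where "Lh \<eta> = (\<integral>c. complex_of_real (exp (\<eta> * c)) * h c \<partial>lborel)" for \<eta>
  define \<Phi> where "\<Phi> w = f (horizontal (fst w), snd w) * h (fst w $ 3)" for w :: "(real^3) \<times> real"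
  have cLh: "continuous_on UNIV Lh" unfolding Lh_def using continuous_on_laplace[OF h(1,2) r(1)] .
  have i\<Phi>: "integrable lborel \<Phi>" unfolding \<Phi>_def by (rule integral_tensor_source(1)[OF f(1) h(1)])
  have f_supp: "norm a \<le> r \<and> 0 \<le> s \<and> s \<le> T\<^sub>0" if "f (a, s) \<noteq> 0" for a s
    using f(2)[of "(a, s)"] that by auto
  have supp: "norm (horizontal y) \<le> r \<and> \<bar>y $ 3\<bar> \<le> r \<and> 0 \<le> s \<and> s \<le> T\<^sub>0" if "\<Phi> (y, s) \<noteq> 0" for y s
    using that f_supp[of "horizontal y" s] h(2)[of "y $ 3"] by (force simp: \<Phi>_def)
  have supp_norm: "norm y \<le> sqrt 2 * r" if "\<Phi> (y, s) \<noteq> 0" for y s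
    using supp[OF that] by (intro norm_le_sqrt2_if_cylinder) auto
  obtain \<eta>\<^sub>0 where \<eta>: "\<eta>\<^sub>0 \<noteq> 0" "Lh \<eta>\<^sub>0 \<noteq> 0"
  proof -
    have "\<exists>\<eta>\<in>- {0}. Lh \<eta> \<noteq> 0"
    proof (rule ccontr)
      assume "\<not> ?thesis"
      then have "AE c in lborel. h c = 0"
        by (intro AE_zero_if_complex_laplace_zero_on_open[OF h(1), of "cball 0 r" "- {0}" 1])
          (use h(2) in \<open>auto simp: Lh_def\<close>)
      then show False using h(3) by simp
    qed
    then show thesis using that by blast
  qed
  define q where "q w = sqrt ((snd w)\<^sup>2 - (norm (fst w))\<^sup>2)" for w :: "(real^2) \<times> real"
  \<comment> \<open>Chosen so that \<open>|\<theta>\<^sub>3| < \<epsilon>\<close> is equivalent to \<open>r + |\<theta>\<^sub>3| r < R\<^sub>0\<close>.\<close>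
  define \<epsilon> where "\<epsilon> = (R\<^sub>0 - r) / r"
  have \<epsilon>: "\<epsilon> > 0" using r by (simp add: \<epsilon>_def)
  define U where "U = {w. snd w < 0} \<inter> {w. (norm (fst w))\<^sup>2 < (snd w)\<^sup>2} \<inter> {w. q w < \<epsilon> * (- snd w)} \<inter> {w. Lh (sgn \<eta>\<^sub>0 * q w) \<noteq> 0}"
  have cq: "continuous_on UNIV q" unfolding q_def by (intro continuous_intros)
  have U: "open U" unfolding U_def
    by (intro open_Int open_Collect_less open_Collect_neq continuous_intros cq continuous_on_compose2[OF cLh]) auto
  have zero: "Lf w = 0" if w: "w \<in> U" for w
  proof -
    define l where "l = - snd w"
    define \<theta>\<^sub>3 where "\<theta>\<^sub>3 = sgn \<eta>\<^sub>0 * q w / l"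
    define \<theta> :: "real^3" where "\<theta> = vector [fst w $ 1 / l, fst w $ 2 / l, \<theta>\<^sub>3]"
    have l: "l > 0" and lt: "(norm (fst w))\<^sup>2 < l\<^sup>2" and qe: "q w < \<epsilon> * l" and Lh: "Lh (sgn \<eta>\<^sub>0 * q w) \<noteq> 0"
      using w by (auto simp: U_def l_def)
    have q2: "(q w)\<^sup>2 = l\<^sup>2 - (norm (fst w))\<^sup>2" "0 \<le> q w" using lt by (auto simp: q_def l_def)
    have sg: "(sgn \<eta>\<^sub>0)\<^sup>2 = 1" using \<eta> by (simp add: sgn_if)
    have h\<theta>: "horizontal \<theta> = (1 / l) *\<^sub>R fst w" by (simp add: \<theta>_def horizontal_def vec_eq_iff forall_2)
    have \<theta>3: "\<theta> $ 3 = \<theta>\<^sub>3" by (simp add: \<theta>_def)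
    have "(norm \<theta>)\<^sup>2 = (norm (fst w))\<^sup>2 / l\<^sup>2 + (q w)\<^sup>2 / l\<^sup>2"
      unfolding norm_horizontal h\<theta> \<theta>3 by (simp add: \<theta>\<^sub>3_def power_mult_distrib power_divide sg)
    also have "\<dots> = 1" unfolding q2 using l by (simp add: add_divide_distrib[symmetric])
    finally have n\<theta>: "norm \<theta> = 1" by (smt (verit) norm_ge_zero power2_eq_1_iff)
    have nh: "norm (horizontal \<theta>) \<le> 1"
    proof (rule power2_le_imp_le)
      show "(norm (horizontal \<theta>))\<^sup>2 \<le> 1\<^sup>2" using norm_horizontal[of \<theta>] zero_le_power2[of "\<theta> $ 3"] unfolding n\<theta> by linarith
    qed simp
    have n3: "r + \<bar>\<theta>\<^sub>3\<bar> * r < R\<^sub>0"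
    proof -
      have "\<bar>\<theta>\<^sub>3\<bar> = q w / l" using \<eta> q2 l by (simp add: \<theta>\<^sub>3_def abs_mult abs_sgn_eq)
      also have "\<dots> < \<epsilon>" using qe l by (simp add: pos_divide_less_eq)
      finally have "\<bar>\<theta>\<^sub>3\<bar> * r < \<epsilon> * r" using r by simp
      then show ?thesis using r by (simp add: \<epsilon>_def)
    qed
    have "(\<integral>w. complex_of_real (exp (l * (\<theta> \<bullet> fst w - snd w))) * \<Phi> w \<partial>lborel) = 0"
    proof (rule plane_wave_integrals_zero[OF _ i\<Phi>, where c = "T\<^sub>0 + (r + \<bar>\<theta>\<^sub>3\<bar> * r)" and \<rho> = "sqrt 2 * r" and R = R and T = T])
      show "norm y \<le> sqrt 2 * r \<and> 0 \<le> s" if "\<Phi> (y, s) \<noteq> 0" for y s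
        using supp[OF that] supp_norm[OF that] by simp
      show "AE t in lborel. 0 < t \<longrightarrow> t < T \<longrightarrow> (\<integral>y. \<Phi> (y, t - norm (x - y)) / complex_of_real (norm (x - y)) \<partial>lborel) = 0"
        if "norm x = R" for x using trace[OF that] by (simp add: \<Phi>_def)
      show "s - \<theta> \<bullet> y \<le> T\<^sub>0 + (r + \<bar>\<theta>\<^sub>3\<bar> * r)" if "\<Phi> (y, s) \<noteq> 0" for y s
      proof -
        have "\<bar>horizontal \<theta> \<bullet> horizontal y\<bar> \<le> norm (horizontal \<theta>) * norm (horizontal y)" by (rule Cauchy_Schwarz_ineq2)
        also have "\<dots> \<le> 1 * r" using nh supp[OF that] r by (intro mult_mono) auto
        finally have "\<bar>horizontal \<theta> \<bullet> horizontal y\<bar> \<le> r" by simp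
        moreover have "\<bar>\<theta>\<^sub>3 * y $ 3\<bar> \<le> \<bar>\<theta>\<^sub>3\<bar> * r"
          unfolding abs_mult using supp[OF that] by (intro mult_left_mono) auto
        ultimately show ?thesis
          using supp[OF that] unfolding inner_horizontal[of \<theta> y] \<theta>3 by linarith
      qed
      show "T\<^sub>0 + (r + \<bar>\<theta>\<^sub>3\<bar> * r) < T - R" using n3 T by linarith
    qed (use r n\<theta> in auto)
    moreover have "complex_of_real (exp (l * (\<theta> \<bullet> fst v - snd v))) * \<Phi> v
      = (complex_of_real (exp (w \<bullet> (horizontal (fst v), snd v))) * f (horizontal (fst v), snd v))
        * (complex_of_real (exp (sgn \<eta>\<^sub>0 * q w * (fst v $ 3))) * h (fst v $ 3))" for v
    proof -
      have "l * (\<theta> \<bullet> fst v - snd v) = w \<bullet> (horizontal (fst v), snd v) + sgn \<eta>\<^sub>0 * q w * (fst v $ 3)"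
        unfolding inner_horizontal[of \<theta>] h\<theta> \<theta>3 \<theta>\<^sub>3_def
        using l by (simp add: inner_prod_def field_simps) (simp add: l_def)
      then show ?thesis by (simp add: exp_add \<Phi>_def)
    qed
    ultimately have "(\<integral>v. (complex_of_real (exp (w \<bullet> (horizontal (fst v), snd v))) * f (horizontal (fst v), snd v))
        * (complex_of_real (exp (sgn \<eta>\<^sub>0 * q w * (fst v $ 3))) * h (fst v $ 3)) \<partial>lborel) = 0"
      by simp
    moreover have "integrable lborel (\<lambda>u. complex_of_real (exp (w \<bullet> u)) * f u)"
      "integrable lborel (\<lambda>c. complex_of_real (exp (sgn \<eta>\<^sub>0 * q w * c)) * h c)"
    proof -
      show "integrable lborel (\<lambda>u. complex_of_real (exp (w \<bullet> u)) * f u)"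
        by (rule integrable_exp_mult_compact_support[OF f(1), of "cball 0 r \<times> {0..T\<^sub>0}"]) (use f(2) in \<open>auto intro!: compact_Times\<close>)
      show "integrable lborel (\<lambda>c. complex_of_real (exp (sgn \<eta>\<^sub>0 * q w * c)) * h c)"
        using integrable_exp_mult_compact_support[OF h(1), of "cball 0 r" "sgn \<eta>\<^sub>0 * q w"] h(2) by auto
    qed
    ultimately have "Lf w * Lh (sgn \<eta>\<^sub>0 * q w) = 0"
      unfolding Lf_def Lh_def
      using integral_tensor_source(2)[of "\<lambda>u. complex_of_real (exp (w \<bullet> u)) * f u" "\<lambda>c. complex_of_real (exp (sgn \<eta>\<^sub>0 * q w * c)) * h c"]
      by simp
    then show ?thesis using Lh by simp
  qed
  \<comment> \<open>A point of \<open>U\<close>: for \<open>l = L\<close> large enough, \<open>l|\<theta>\<^sub>3| = |\<eta>\<^sub>0|\<close> is compatible with \<open>|\<theta>\<^sub>3| < \<epsilon>\<close>.\<close>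
  define L where "L = \<bar>\<eta>\<^sub>0\<bar> / \<epsilon> + \<bar>\<eta>\<^sub>0\<bar> + 1"
  have L: "L > \<bar>\<eta>\<^sub>0\<bar>" "\<epsilon> * L > \<bar>\<eta>\<^sub>0\<bar>" "L > 0"
    using \<epsilon> by (auto simp: L_def distrib_left add_pos_nonneg intro: add_nonneg_pos)
  define w\<^sub>0 :: "(real^2) \<times> real" where "w\<^sub>0 = (sqrt (L\<^sup>2 - \<eta>\<^sub>0\<^sup>2) *\<^sub>R axis 1 1, - L)"
  have "\<eta>\<^sub>0\<^sup>2 < L\<^sup>2" using power_strict_mono[of "\<bar>\<eta>\<^sub>0\<bar>" L 2] L by simp
  then have n: "(norm (fst w\<^sub>0))\<^sup>2 = L\<^sup>2 - \<eta>\<^sub>0\<^sup>2" by (simp add: w\<^sub>0_def norm_axis_1)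
  have "q w\<^sub>0 = \<bar>\<eta>\<^sub>0\<bar>" unfolding q_def n by (simp add: w\<^sub>0_def)
  then have "w\<^sub>0 \<in> U" using \<eta> L n by (simp add: U_def w\<^sub>0_def sgn_mult_abs)
  then show ?thesis
    by (intro AE_zero_if_complex_laplace_zero_on_open[OF f(1), of "cball 0 r \<times> {0..T\<^sub>0}" U])
      (use f(2) U zero in \<open>auto simp: Lf_def intro!: compact_Times\<close>)
qed

section \<open>Borel representatives and the theorem\<close>

text \<open>The complement of the support is a union of possibly uncountably many open sets on each of which \<open>f\<close> vanishes
  almost everywhere; by Lindelof's theorem countably many of them suffice.\<close>

lemma AE_zero_outside_ess_support:
  fixes f :: "'a::euclidean_space \<Rightarrow> complex"
  shows "AE x in lebesgue. x \<notin> ess_support f \<longrightarrow> f x = 0"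
proof -
  let ?F = "{U. open U \<and> (AE x in lebesgue. x \<in> U \<longrightarrow> f x = 0)}"
  obtain F' where F': "F' \<subseteq> ?F" "countable F'" "\<Union>F' = \<Union>?F"
    by (rule Lindelof[of ?F]) auto
  have "AE x in lebesgue. \<forall>U\<in>F'. x \<in> U \<longrightarrow> f x = 0"
    using F' by (subst AE_ball_countable) auto
  then show ?thesis
    unfolding ess_support_def F'(3)[symmetric] by eventually_elim auto
qed

lemma closed_ess_support: "closed (ess_support f)"
  unfolding ess_support_def closed_def by auto

lemma lebesgue_measurable_ex_borel_complex:
  fixes f :: "'a::euclidean_space \<Rightarrow> complex"
  assumes "f \<in> borel_measurable lebesgue"
  obtains g where "g \<in> borel_measurable borel" "AE x in lborel. f x = g x"
proof -
  have "(\<lambda>x. Re (f x)) \<in> borel_measurable lebesgue" "(\<lambda>x. Im (f x)) \<in> borel_measurable lebesgue"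
    using assms by auto
  then obtain u v where u: "u \<in> borel_measurable lborel" "AE x in lborel. Re (f x) = u x"
    and v: "v \<in> borel_measurable lborel" "AE x in lborel. Im (f x) = v x"
    by (metis completion_ex_borel_measurable_real)
  show thesis
  proof
    show "(\<lambda>x. Complex (u x) (v x)) \<in> borel_measurable borel"
      using u v by (simp add: borel_measurable_complex_iff)
    show "AE x in lborel. f x = Complex (u x) (v x)"
      using u(2) v(2) by eventually_elim (simp add: complex_eq_iff)
  qed
qed

text \<open>The dominating function is split as \<open>1\<^sub>K + w\<close> so that one lemma serves both integrable functions
  (with \<open>w = |f|\<close>) and square-integrable ones (with \<open>w = |f|\<^sup>2\<close>, by \<open>|f| \<le> 1 + |f|\<^sup>2\<close>).\<close>

lemma borel_representative:
  fixes f :: "'a::euclidean_space \<Rightarrow> complex"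
  assumes f: "f \<in> borel_measurable lebesgue" and K: "compact K" "AE x in lebesgue. x \<notin> K \<longrightarrow> f x = 0"
    and w: "integrable lebesgue w" "AE x in lebesgue. norm (f x) \<le> indicator K x + w x"
  obtains g where "integrable lborel g" "AE x in lborel. f x = g x" "\<And>x. x \<notin> K \<Longrightarrow> g x = 0"
proof -
  obtain g where g[measurable]: "g \<in> borel_measurable borel" and fg: "AE x in lborel. f x = g x"
    using lebesgue_measurable_ex_borel_complex[OF f] .
  have [measurable]: "K \<in> sets borel" using K(1) by (simp add: borel_compact)
  define g' where "g' x = indicator K x *\<^sub>R g x" for x
  have g'[measurable]: "g' \<in> borel_measurable borel" unfolding g'_def by measurable
  have ae: "AE x in lebesgue. f x = g' x"
    using K(2) AE_completion[OF fg] by eventually_elim (auto simp: g'_def indicator_def)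
  have "integrable lebesgue g'"
  proof (rule Bochner_Integration.integrable_bound)
    have "emeasure lborel K < \<infinity>" using K(1) by (rule emeasure_compact_finite)
    then have "integrable lborel (indicator K :: 'a \<Rightarrow> real)" by (simp add: integrable_indicator_iff)
    then have "integrable lebesgue (indicator K :: 'a \<Rightarrow> real)" by (simp add: integrable_completion)
    then show "integrable lebesgue (\<lambda>x. indicator K x + w x)" using w(1) by simp
    show "g' \<in> borel_measurable lebesgue" using g' by (simp add: measurable_completion)
    show "AE x in lebesgue. norm (g' x) \<le> norm (indicator K x + w x)"
      using ae w(2) by eventually_elim (auto intro: order_trans[OF _ abs_ge_self])
  qed
  then have "integrable lborel g'" using g' by (simp add: integrable_completion)
  moreover have "AE x in lborel. f x = g' x" using ae by (simp add: AE_completion_iff)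
  ultimately show thesis by (rule that) (simp add: g'_def)
qed

text \<open>Measurability of \<open>u\<close> is a conclusion here: it follows from that of \<open>v\<close> by completeness.\<close>

lemma lebesgue_integral_eq_lborel_if_AE:
  fixes u v :: "'a::euclidean_space \<Rightarrow> complex"
  assumes v: "v \<in> borel_measurable borel" and ae: "AE x in lborel. u x = v x"
  shows "(\<integral>x. u x \<partial>lebesgue) = (\<integral>x. v x \<partial>lborel)"
proof -
  have v': "v \<in> borel_measurable lebesgue" using v by (simp add: measurable_completion)
  have ae': "AE x in lebesgue. u x = v x" using AE_completion[OF ae] .
  have "u \<in> borel_measurable lebesgue"
  proof (rule measurableI)
    fix A :: "complex set" assume "A \<in> sets borel"
    with v' have A: "v -` A \<inter> space lebesgue \<in> sets lebesgue" by (rule measurable_sets)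
    have "AE x in lebesgue. x \<in> v -` A \<inter> space lebesgue \<longleftrightarrow> x \<in> u -` A \<inter> space lebesgue"
      using ae' by eventually_elim simp
    then show "u -` A \<inter> space lebesgue \<in> sets lebesgue"
      using A by (rule completion.in_sets_AE) simp
  qed simp
  then have "(\<integral>x. u x \<partial>lebesgue) = (\<integral>x. v x \<partial>lebesgue)"
    using v' ae' by (rule integral_cong_AE)
  also have "\<dots> = (\<integral>x. v x \<partial>lborel)" using v by (simp add: integral_completion)
  finally show ?thesis .
qed

text \<open>This yields the slack between \<open>r\<close> and \<open>R\<^sub>0\<close> that makes nearly horizontal directions usable.\<close>

lemma compact_subset_smaller_cball:
  fixes S :: "'a::euclidean_space set"
  assumes S: "compact S" "S \<subseteq> ball 0 r\<^sub>0" and r: "0 < r\<^sub>0"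
  obtains r where "0 < r" "r < r\<^sub>0" "S \<subseteq> cball 0 r"
proof (cases "S = {}")
  case True
  then show thesis using that[of "r\<^sub>0 / 2"] r by simp
next
  case False
  obtain y where y: "y \<in> S" "\<And>z. z \<in> S \<Longrightarrow> norm z \<le> norm y"
    using continuous_attains_sup[OF S(1) False, of norm] by (auto intro: continuous_intros)
  then have "norm y < r\<^sub>0" using S(2) by auto
  then show thesis using that[of "max (norm y) (r\<^sub>0 / 2)"] y r by fastforce
qed

text \<open>The retarded potential of the Lebesgue measurable source agrees, at almost every time, with that of
  its Borel representative. The condition on negative times makes the cut-off at \<open>t < 0\<close> in the definition of
  the source harmless.\<close>

lemma wave_solution_eq:
  fixes f g :: "(real^2) \<times> real \<Rightarrow> complex" and h k :: "real \<Rightarrow> complex"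
  assumes fg: "AE u in lborel. f u = g u" and hk: "AE c in lborel. h c = k c"
    and g: "g \<in> borel_measurable borel" "\<And>a s. s < 0 \<Longrightarrow> g (a, s) = 0" and k: "k \<in> borel_measurable borel"
  shows "AE t in lborel. wave_solution f h x t
    = (\<integral>y. (g (horizontal y, t - norm (x - y)) * k (y $ 3)) / complex_of_real (norm (x - y)) \<partial>lborel) / complex_of_real (4 * pi)"
proof -
  note [measurable] = g(1) k
  obtain N\<^sub>1 where N1: "N\<^sub>1 \<in> null_sets lborel" "\<And>u. u \<notin> N\<^sub>1 \<Longrightarrow> f u = g u"
  proof -
    have "\<exists>N\<in>null_sets lborel. {u \<in> space lborel. f u \<noteq> g u} \<subseteq> N" using fg by (simp add: eventually_ae_filter)
    then show thesis using that by force
  qed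
  obtain N\<^sub>2 where N2: "N\<^sub>2 \<in> null_sets lborel" "\<And>c. c \<notin> N\<^sub>2 \<Longrightarrow> h c = k c"
  proof -
    have "\<exists>N\<in>null_sets lborel. {c \<in> space lborel. h c \<noteq> k c} \<subseteq> N" using hk by (simp add: eventually_ae_filter)
    then show thesis using that by force
  qed
  have [measurable]: "N\<^sub>1 \<in> sets borel" "N\<^sub>2 \<in> sets borel" using N1 N2 by auto
  define N where "N = {w :: (real^3) \<times> real. \<not> ((horizontal (fst w), snd w) \<notin> N\<^sub>1 \<and> fst w $ 3 \<notin> N\<^sub>2)}"
  have N: "N \<in> sets borel"
  proof -
    have "{w \<in> space borel. \<not> ((horizontal (fst w), snd w) \<notin> N\<^sub>1 \<and> (fst w :: real^3) $ 3 \<notin> N\<^sub>2)} \<in> sets borel"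
      by measurable
    then show ?thesis by (simp add: N_def)
  qed
  have "AE t in lborel. AE y in lborel. (y, t - norm (x - y)) \<notin> N"
    by (rule AE_lborel_slices) (use N AE_assemble[OF N1(1) N2(1)] in \<open>auto simp: N_def\<close>)
  then show ?thesis
  proof eventually_elim
    case (elim t)
    have "(\<lambda>y. (horizontal y, t - norm (x - y))) \<in> borel \<rightarrow>\<^sub>M borel" "(\<lambda>y :: real^3. y $ 3) \<in> borel \<rightarrow>\<^sub>M borel"
      by (intro borel_measurable_continuous_onI continuous_intros continuous_on_horizontal)+
    note this[measurable]
    have "wave_solution f h x t = (\<integral>y. g (horizontal y, t - norm (x - y)) * k (y $ 3) / complex_of_real (4 * pi * norm (x - y)) \<partial>lborel)"
      unfolding wave_solution_def retarded_potential_def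
    proof (rule lebesgue_integral_eq_lborel_if_AE)
      show "(\<lambda>y. g (horizontal y, t - norm (x - y)) * k (y $ 3) / complex_of_real (4 * pi * norm (x - y))) \<in> borel_measurable borel"
        by measurable
      show "AE y in lborel. wave_source f h y (t - norm (x - y)) / complex_of_real (4 * pi * norm (x - y)) =
         g (horizontal y, t - norm (x - y)) * k (y $ 3) / complex_of_real (4 * pi * norm (x - y))"
        using elim
      proof eventually_elim
        case (elim y)
        then show ?case using N1(2) N2(2) g(2) by (simp add: N_def wave_source_def)
      qed
    qed
    also have "\<dots> = (\<integral>y. g (horizontal y, t - norm (x - y)) * k (y $ 3) / complex_of_real (norm (x - y)) / complex_of_real (4 * pi) \<partial>lborel)"
      by (simp only: of_real_mult divide_divide_eq_left mult_ac)
    finally show ?case by (simp only: integral_divide_zero)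
  qed
qed

lemma admissible_source_representative:
  assumes "admissible_source R\<^sub>0 T\<^sub>0 f" and r: "fst ` ess_support f \<subseteq> cball 0 r"
  obtains g where "integrable lborel g" "AE u in lborel. f u = g u" "\<And>u. u \<notin> cball 0 r \<times> {0..T\<^sub>0} \<Longrightarrow> g u = 0"
proof (rule borel_representative)
  have f: "f \<in> borel_measurable lebesgue" "integrable lebesgue (\<lambda>x. (norm (f x))\<^sup>2)"
    and s: "ess_support f \<subseteq> ball 0 R\<^sub>0 \<times> {0..T\<^sub>0}"
    using assms(1) by (auto simp: admissible_source_def square_integrable_def)
  show "f \<in> borel_measurable lebesgue" "integrable lebesgue (\<lambda>x. (norm (f x))\<^sup>2)" by fact+
  show "compact (cball (0 :: real^2) r \<times> {0..T\<^sub>0})" by (intro compact_Times) auto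
  have sub: "ess_support f \<subseteq> cball 0 r \<times> {0..T\<^sub>0}" using s r by force
  show *: "AE u in lebesgue. u \<notin> cball 0 r \<times> {0..T\<^sub>0} \<longrightarrow> f u = 0"
    using AE_zero_outside_ess_support[of f] by eventually_elim (use sub in auto)
  show "AE u in lebesgue. norm (f u) \<le> indicator (cball 0 r \<times> {0..T\<^sub>0}) u + (norm (f u))\<^sup>2"
    using *
  proof eventually_elim
    case (elim u)
    have "norm (f u) \<le> 1 + (norm (f u))\<^sup>2"
      using sum_squares_bound[of 1 "norm (f u)"] by (simp add: power2_eq_square) (smt (verit) norm_ge_zero)
    then show ?case using elim by (auto simp: indicator_def)
  qed
qed (use that in blast)

theorem theorem3p3:
  fixes R R\<^sub>0 T\<^sub>0 T :: real
    and h :: "real \<Rightarrow> complex"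
    and f\<^sub>1 f\<^sub>2 :: "(real^2) \<times> real \<Rightarrow> complex"
  assumes "R > 0" and "0 < R\<^sub>0" and "R\<^sub>0 < R / sqrt 2" and "T\<^sub>0 > 0" and "T = T\<^sub>0 + R + R\<^sub>0"
    and "integrable lebesgue h" and "ess_support h \<subseteq> {-R\<^sub>0<..<R\<^sub>0}"
    and "\<not> (AE s in lebesgue. h s = 0)"
    and "admissible_source R\<^sub>0 T\<^sub>0 f\<^sub>1" and "admissible_source R\<^sub>0 T\<^sub>0 f\<^sub>2"
    and "same_boundary_data R T (wave_solution f\<^sub>1 h) (wave_solution f\<^sub>2 h)"
  shows "AE p in lebesgue. f\<^sub>1 p = f\<^sub>2 p"
proof -
  have hs: "compact (ess_support h)" "ess_support h \<subseteq> ball 0 R\<^sub>0"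
  proof -
    show s: "ess_support h \<subseteq> ball 0 R\<^sub>0" using assms(7) by (force simp: dist_norm abs_less_iff subset_iff)
    then have "bounded (ess_support h)" by (rule bounded_subset[OF bounded_ball])
    then show "compact (ess_support h)" using closed_ess_support by (simp add: compact_eq_bounded_closed)
  qed
  have fs: "compact (fst ` ess_support f)" "fst ` ess_support f \<subseteq> ball 0 R\<^sub>0" if "admissible_source R\<^sub>0 T\<^sub>0 f" for f
    using that by (auto simp: admissible_source_def intro!: compact_continuous_image continuous_intros)
  obtain r\<^sub>h r\<^sub>1 r\<^sub>2 where r: "0 < r\<^sub>h" "r\<^sub>h < R\<^sub>0" "ess_support h \<subseteq> cball 0 r\<^sub>h"
    "r\<^sub>1 < R\<^sub>0" "fst ` ess_support f\<^sub>1 \<subseteq> cball 0 r\<^sub>1" "r\<^sub>2 < R\<^sub>0" "fst ` ess_support f\<^sub>2 \<subseteq> cball 0 r\<^sub>2"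
    using compact_subset_smaller_cball[OF hs assms(2)] compact_subset_smaller_cball[OF fs[OF assms(9)] assms(2)]
      compact_subset_smaller_cball[OF fs[OF assms(10)] assms(2)] by metis
  define r where "r = max r\<^sub>h (max r\<^sub>1 r\<^sub>2)"
  have r0: "0 < r" "r < R\<^sub>0" using r by (auto simp: r_def)
  have sub: "cball 0 r\<^sub>h \<subseteq> cball (0::real) r" "cball 0 r\<^sub>1 \<subseteq> cball (0::real^2) r" "cball 0 r\<^sub>2 \<subseteq> cball (0::real^2) r"
    by (auto simp: r_def)
  have "sqrt 2 * R\<^sub>0 < R" using assms(3) by (simp add: pos_less_divide_eq mult.commute)
  moreover have "sqrt 2 * r < sqrt 2 * R\<^sub>0" using r0 by simp
  ultimately have rR: "sqrt 2 * r < R" by linarith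
  obtain g\<^sub>1 where g1: "integrable lborel g\<^sub>1" "AE u in lborel. f\<^sub>1 u = g\<^sub>1 u" "\<And>u. u \<notin> cball 0 r \<times> {0..T\<^sub>0} \<Longrightarrow> g\<^sub>1 u = 0"
    by (rule admissible_source_representative[OF assms(9) subset_trans[OF r(5) sub(2)]], rule that, assumption+)
  obtain g\<^sub>2 where g2: "integrable lborel g\<^sub>2" "AE u in lborel. f\<^sub>2 u = g\<^sub>2 u" "\<And>u. u \<notin> cball 0 r \<times> {0..T\<^sub>0} \<Longrightarrow> g\<^sub>2 u = 0"
    by (rule admissible_source_representative[OF assms(10) subset_trans[OF r(7) sub(3)]], rule that, assumption+)
  obtain k where k: "integrable lborel k" "AE c in lborel. h c = k c" "\<And>c. c \<notin> cball 0 r \<Longrightarrow> k c = 0"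
  proof (rule borel_representative[of h "cball 0 r" "\<lambda>c. norm (h c)"])
    show "AE c in lebesgue. c \<notin> cball 0 r \<longrightarrow> h c = 0"
      using AE_zero_outside_ess_support[of h] by eventually_elim (use r(3) sub(1) in auto)
  qed (use assms(6) that in auto)
  have k0: "k c = 0" if "\<bar>c\<bar> > r" for c using k(3)[of c] that by simp
  have \<Phi>i: "integrable lborel (\<lambda>w :: (real^3) \<times> real. g (horizontal (fst w), snd w) * k (fst w $ 3))" if "integrable lborel g" for g
    by (rule integral_tensor_source(1)[OF that k(1)])
  have "AE u in lborel. g\<^sub>1 u - g\<^sub>2 u = 0"
  proof (rule tensor_source_zero[where h = k and r = r and R\<^sub>0 = R\<^sub>0 and T\<^sub>0 = T\<^sub>0 and R = R and T = T])
    show "\<not> (AE c in lborel. k c = 0)"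
    proof
      assume "AE c in lborel. k c = 0"
      with k(2) have "AE c in lborel. h c = 0" by eventually_elim simp
      then show False using assms(8) AE_completion by blast
    qed
    fix x :: "real^3" assume x: "norm x = R"
    have supp: "norm y \<le> sqrt 2 * r" if "g (horizontal y, s) * k (y $ 3) \<noteq> 0" "\<And>u. u \<notin> cball 0 r \<times> {0..T\<^sub>0} \<Longrightarrow> g u = 0"
      for g y and s :: real
    proof (rule norm_le_sqrt2_if_cylinder)
      show "norm (horizontal y) \<le> r" "\<bar>y $ 3\<bar> \<le> r"
        using that(1) k0[of "y $ 3"] that(2)[of "(horizontal y, s)"] by force+
    qed
    have g0: "\<forall>u. u \<notin> cball 0 r \<times> {0..T\<^sub>0} \<longrightarrow> g\<^sub>1 u = 0" "\<forall>u. u \<notin> cball 0 r \<times> {0..T\<^sub>0} \<longrightarrow> g\<^sub>2 u = 0"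
      using g1(3) g2(3) by blast+
    have int: "AE t in lborel. integrable lborel (\<lambda>y. (g (horizontal y, t - norm (x - y)) * k (y $ 3)) / complex_of_real (norm (x - y)))"
      if g: "integrable lborel g" "\<forall>u. u \<notin> cball 0 r \<times> {0..T\<^sub>0} \<longrightarrow> g u = 0" for g
    proof -
      have "norm y \<le> sqrt 2 * r"
        if "(\<lambda>w :: (real^3) \<times> real. g (horizontal (fst w), snd w) * k (fst w $ 3)) (y, s) \<noteq> 0" for y s
        by (rule supp[where g = g and s = s]) (use that in simp, use g(2) in blast)
      then have "AE t in lborel. integrable lborel (\<lambda>y. (\<lambda>w. g (horizontal (fst w), snd w) * k (fst w $ 3)) (y, t - norm (x - y))
          / complex_of_real (norm (x - y)))"
        using x rR by (intro AE_integrable_retarded[OF \<Phi>i[OF g(1)], of "sqrt 2 * r"]) auto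
      then show ?thesis by simp
    qed
    have sol: "AE t in lborel. wave_solution f h x t
      = (\<integral>y. (g (horizontal y, t - norm (x - y)) * k (y $ 3)) / complex_of_real (norm (x - y)) \<partial>lborel) / complex_of_real (4 * pi)"
      if "integrable lborel g" "AE u in lborel. f u = g u" "\<forall>u. u \<notin> cball 0 r \<times> {0..T\<^sub>0} \<longrightarrow> g u = 0" for f g
      using that k by (intro wave_solution_eq) auto
    have data: "AE t in lborel. t \<in> {0<..<T} \<longrightarrow> wave_solution f\<^sub>1 h x t = wave_solution f\<^sub>2 h x t"
      using assms(11) x by (auto simp: same_boundary_data_def AE_completion_iff)
    show "AE t in lborel. 0 < t \<longrightarrow> t < T \<longrightarrow>
       (\<integral>y. ((g\<^sub>1 (horizontal y, t - norm (x - y)) - g\<^sub>2 (horizontal y, t - norm (x - y))) * k (y $ 3)) / complex_of_real (norm (x - y)) \<partial>lborel) = 0"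
      using data sol[OF g1(1,2) g0(1)] sol[OF g2(1,2) g0(2)] int[OF g1(1) g0(1)] int[OF g2(1) g0(2)]
      by eventually_elim (simp add: left_diff_distrib diff_divide_distrib)
  qed (use g1 g2 k k0 r0 rR assms(5) in auto)
  with g1(2) g2(2) have "AE p in lborel. f\<^sub>1 p = f\<^sub>2 p" by eventually_elim simp
  then show ?thesis by (rule AE_completion)
qed

end
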